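(* Let $\mathcal{T}_r=(\mathcal{V},\mathcal{E}_r)$ be a rooted directed tree with $\mathcal{V}=\{1,\dots,J\}$, set of leaves $\mathcal{L}$ and root $r=1\in\mathcal{L}$, let $\mathcal{T}=(\mathcal{V},\mathcal{E})$ be its undirected counterpart, and let $\mu_j\in\mathbb{R}_+^n$, $j\in\mathcal{L}$, be given marginals (of equal total mass). Let $A^{(j_1,j_2)}\in\mathbb{R}_+^{n\times n}$, $(j_1,j_2)\in\mathcal{E}_r$, be transition probability (row-stochastic) matrices, and let $\epsilon>0$ and $C^{(j_1,j_2)}\in\mathbb{R}_+^{n\times n}$ be such that $K^{(j_1,j_2)}:=\exp(-C^{(j_1,j_2)}/\epsilon)=A^{(j_1,j_2)}$ for all $(j_1,j_2)\in\mathcal{E}_r$. Let $\mathbf{M}=\mathbf{K}\odot\mathbf{U}$ be the solution to the entropy regularized multi-marginal optimal transport problem (MOT) on $\mathcal{T}$, where $\mathbf{K}_{i_1,\dots,i_J}=\prod_{(j_1,j_2)\in\mathcal{E}_r}K^{(j_1,j_2)}_{i_{j_1},i_{j_2}}$ and $\mathbf{U}=u_1\otimes\dots\otimes u_J$ with $u_j=\mathbf{1}$ for $j\notin\mathcal{L}$. Moreover, let $\mu_j$, $j\in\mathcal{V}$, and $M^{(j_1,j_2)}$, $(j_1,j_2)\in\mathcal{E}_r$, be the solution to the tree-structured Schrödinger bridge problem (SB) on $\mathcal{T}_r$. Then $$P_j(\mathbf{M})=\mu_j\ \text{ for } j\in\mathcal{V},\qquad P_{j_1,j_2}(\mathbf{M})=M^{(j_1,j_2)}\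 \text{ for }(j_1,j_2)\in\mathcal{E}_r .$$ Furthermore, if $v_j$, $j\in\mathcal{L}$, are the corresponding vectors in the representation (R) of the solution of (SB) given in the context, then it holds that $$u_j=\begin{cases}\mathbf{1}./v_1,&\text{if } j=1,\\ v_j,&\text{otherwise }(j\in\mathcal{L}\setminus\{1\}).\end{cases}$$
   Context: Elementwise operations: $\exp$, $\odot$ (product), $./$ (division); $\otimes$ is the outer product; $\mathbf{1}$ is the all-ones vector. Leaves are vertices of degree 1. All edges of $\mathcal{T}_r$ are directed away from the root; for $j\neq 1$, $p(j)$ is the parent of $j$, i.e. the unique vertex with $(p(j),j)\in\mathcal{E}_r$. For nonnegative $p,q$ of the same dimensions, $H(p|q)=\sum_i\big(p_i\log(p_i/q_i)-p_i+q_i\big)$ with $0\log 0=0$, and $H(p)=H(p|\mathbf{1})$ ($\mathbf{1}$ here the all-ones array). For a $J$-mode tensor $\mathbf{M}$: $P_j(\mathbf{M})\in\mathbb{R}^n$ is obtained by summing $\mathbf{M}_{i_1,\dots,i_J}$ over all indices except $i_j$; $P_{j_1,j_2}(\mathbf{M})\in\mathbb{R}^{n\times n}$ is obtained by summing over all indices except $i_{j_1},i_{j_2}$ (rows indexed by $i_{j_1}$). (MOT): minimize $\langle\mathbf{C},\mathbf{M}\rangle+\epsilon H(\mathbf{M})$ over $\mathbf{M}\in\mathbb{R}_+^{n\times\dots\times n}$ ($J$ modes) subject to $P_j(\mathbf{M})=\mu_j$ for $j\in\mathcal{L}$, where $\mathbf{C}_{i_1,\dots,i_J}=\sum_{(j_1,j_2)\in\mathcal{E}_r}C^{(j_1,j_2)}_{i_{j_1},i_{j_2}}$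 and $\langle\cdot,\cdot\rangle$ is the standard inner product. (SB): minimize $\sum_{(j_1,j_2)\in\mathcal{E}_r}H\big(M^{(j_1,j_2)}\,|\,\mathrm{diag}(\mu_{j_1})A^{(j_1,j_2)}\big)$ over nonnegative matrices $M^{(j_1,j_2)}\in\mathbb{R}_+^{n\times n}$, $(j_1,j_2)\in\mathcal{E}_r$, and vectors $\mu_j\in\mathbb{R}_+^n$, $j\in\mathcal{V}\setminus\mathcal{L}$, subject to $M^{(j_1,j_2)}\mathbf{1}=\mu_{j_1}$ and $(M^{(j_1,j_2)})^T\mathbf{1}=\mu_{j_2}$ for all $(j_1,j_2)\in\mathcal{E}_r$ (the $\mu_j$, $j\in\mathcal{L}$, being given). (R): $\mu_j=\varphi_j\odot\hat\varphi_j$ for $j\in\mathcal{V}$ and $M^{(j_1,j_2)}=\mathrm{diag}(\hat\varphi_{j_1}\odot\varphi_{j_1\setminus j_2})A^{(j_1,j_2)}\mathrm{diag}(\varphi_{j_2})$ for $(j_1,j_2)\in\mathcal{E}_r$, where $\varphi_j=v_j$ if $j\in\mathcal{L}\setminus\{1\}$ and $\varphi_j=\bigodot_{k:(j,k)\in\mathcal{E}_r}A^{(j,k)}\varphi_k$ otherwise; $\hat\varphi_1=\mathbf{1}./v_1$ and $\hat\varphi_j=(A^{(p(j),j)})^T(\hat\varphi_{p(j)}\odot\varphi_{p(j)\setminus j})$ for $j\ne1$; and $\varphi_{j_1\setminus j_2}=\varphi_{j_1}./(A^{(j_1,j_2)}\varphi_{j_2})$.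
   Formalization: The vectors u_j and v_j are unique only up to scalars of product 1, so u_j equals the stated vector for a suitable choice of v and up to such scalars for every v in (R); this part assumes nonzero marginals, and 1/0 = 0 encodes v_1 infinite where μ_1 vanishes. *)

theory Defs
  imports "HOL-Analysis.Analysis"
begin

text \<open>
  The vertex set is the whole of a finite type \<open>'v\<close> (so \<open>J = CARD('v)\<close>), with an arbitrary
  distinguished vertex in the role of the root 1. Vectors are \<open>real ^ 'n\<close>, so \<open>n = CARD('n)\<close>.
  A \<open>J\<close>-mode tensor is a vector whose index is the family of its \<open>J\<close> indices,
  \<open>i :: 'v \<Rightarrow> 'n\<close>; its inner product is the standard one.
  On \<open>real ^ _\<close> the library's \<open>(*)\<close>, \<open>1\<close>, \<open>prod\<close> and \<open>(\<le>)\<close> are the elementwise ones.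
\<close>

section \<open>Rooted directed trees\<close>

definition adj :: "('v \<times> 'v) set \<Rightarrow> 'v \<Rightarrow> 'v \<Rightarrow> bool" where
  "adj E a b \<longleftrightarrow> (a, b) \<in> E \<or> (b, a) \<in> E"

definition simple_path :: "('v \<times> 'v) set \<Rightarrow> 'v \<Rightarrow> 'v list \<Rightarrow> 'v \<Rightarrow> bool" where
  "simple_path E a p b \<longleftrightarrow>
     p \<noteq> [] \<and> hd p = a \<and> last p = b \<and> distinct p \<and> successively (adj E) p"

definition undirected_tree :: "('v \<times> 'v) set \<Rightarrow> bool" where
  "undirected_tree E \<longleftrightarrow> (\<forall>a. \<not> adj E a a) \<and> (\<forall>a b. \<exists>!p. simple_path E a p b)"

text \<open>An edge \<open>(a, b)\<close> points away from the root if it is the last edge of a path from the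
  root to \<open>b\<close>. In a tree at most one of \<open>(a, b)\<close> and \<open>(b, a)\<close> can satisfy this.\<close>

definition rooted_tree :: "('v \<times> 'v) set \<Rightarrow> 'v \<Rightarrow> bool" where
  "rooted_tree E r \<longleftrightarrow>
     undirected_tree E \<and> (\<forall>(a, b) \<in> E. \<exists>p. simple_path E r (p @ [a, b]) b)"

definition leaves :: "('v::finite \<times> 'v) set \<Rightarrow> 'v set" where
  "leaves E = {j. card {k. adj E j k} = 1}"

definition parent :: "('v \<times> 'v) set \<Rightarrow> 'v \<Rightarrow> 'v" where
  "parent E j = (THE i. (i, j) \<in> E)"

section \<open>Vectors, matrices, tensors\<close>

definition vdiv :: "real ^ 'n \<Rightarrow> real ^ 'n \<Rightarrow> real ^ 'n" (infixl ".'/" 70) where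
  "x ./ y = (\<chi> i. x $ i / y $ i)"

definition diag :: "real ^ 'n \<Rightarrow> real ^ 'n ^ 'n" where
  "diag x = (\<chi> i k. if i = k then x $ i else 0)"

definition gibbs :: "real \<Rightarrow> real ^ 'n ^ 'n \<Rightarrow> real ^ 'n ^ 'n" where
  "gibbs \<epsilon> C = (\<chi> i k. exp (- C $ i $ k / \<epsilon>))"

definition row_stochastic :: "real ^ 'n ^ 'n \<Rightarrow> bool" where
  "row_stochastic A \<longleftrightarrow> 0 \<le> A \<and> A *v 1 = 1"

definition cost_tensor :: "('v::finite \<times> 'v) set \<Rightarrow> ('v \<Rightarrow> 'v \<Rightarrow> real ^ 'n ^ 'n) \<Rightarrow>
    real ^ ('v \<Rightarrow> 'n::finite)" where
  "cost_tensor E C = (\<chi> i. \<Sum>(a, b)\<in>E. C a b $ i a $ i b)"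

definition kernel_tensor :: "('v::finite \<times> 'v) set \<Rightarrow> ('v \<Rightarrow> 'v \<Rightarrow> real ^ 'n ^ 'n) \<Rightarrow>
    real ^ ('v \<Rightarrow> 'n::finite)" where
  "kernel_tensor E K = (\<chi> i. \<Prod>(a, b)\<in>E. K a b $ i a $ i b)"

definition outer :: "('v::finite \<Rightarrow> real ^ 'n) \<Rightarrow> real ^ ('v \<Rightarrow> 'n::finite)" where
  "outer u = (\<chi> i. \<Prod>j\<in>UNIV. u j $ i j)"

definition proj :: "'v::finite \<Rightarrow> real ^ ('v \<Rightarrow> 'n::finite) \<Rightarrow> real ^ 'n" where
  "proj j M = (\<chi> x. \<Sum>i | i j = x. M $ i)"

definition proj2 :: "'v::finite \<Rightarrow> 'v \<Rightarrow> real ^ ('v \<Rightarrow> 'n::finite) \<Rightarrow> real ^ 'n ^ 'n" where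
  "proj2 j k M = (\<chi> x y. \<Sum>i | i j = x \<and> i k = y. M $ i)"

text \<open>Relative entropy of nonnegative arrays, with the usual conventions \<open>0 log (0/q) = 0\<close> for
  \<open>q \<ge> 0\<close> and \<open>p log (p/0) = \<infinity>\<close> for \<open>p > 0\<close>.\<close>

definition rel_entropy :: "('i::finite \<Rightarrow> real) \<Rightarrow> ('i \<Rightarrow> real) \<Rightarrow> ereal" where
  "rel_entropy p q = (\<Sum>i\<in>UNIV.
     if p i = 0 then ereal (q i)
     else if q i = 0 then \<infinity>
     else ereal (p i * ln (p i / q i) - p i + q i))"

section \<open>Entropy regularized multi-marginal optimal transport\<close>

definition MOT_objective :: "('v::finite \<times> 'v) set \<Rightarrow> ('v \<Rightarrow> 'v \<Rightarrow> real ^ 'n ^ 'n) \<Rightarrow> real \<Rightarrow>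
    real ^ ('v \<Rightarrow> 'n::finite) \<Rightarrow> ereal" where
  "MOT_objective E C \<epsilon> M =
     ereal (cost_tensor E C \<bullet> M) + ereal \<epsilon> * rel_entropy (\<lambda>i. M $ i) (\<lambda>i. 1)"

definition MOT_feasible :: "('v::finite \<times> 'v) set \<Rightarrow> ('v \<Rightarrow> real ^ 'n) \<Rightarrow>
    real ^ ('v \<Rightarrow> 'n::finite) \<Rightarrow> bool" where
  "MOT_feasible E \<mu> M \<longleftrightarrow> 0 \<le> M \<and> (\<forall>j \<in> leaves E. proj j M = \<mu> j)"

definition MOT_solution :: "('v::finite \<times> 'v) set \<Rightarrow> ('v \<Rightarrow> 'v \<Rightarrow> real ^ 'n ^ 'n) \<Rightarrow> real \<Rightarrow>
    ('v \<Rightarrow> real ^ 'n) \<Rightarrow> real ^ ('v \<Rightarrow> 'n::finite) \<Rightarrow> bool" where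
  "MOT_solution E C \<epsilon> \<mu> M \<longleftrightarrow> is_arg_min (MOT_objective E C \<epsilon>) (MOT_feasible E \<mu>) M"

section \<open>Tree-structured Schroedinger bridge\<close>

text \<open>The given marginals are \<open>\<mu> j\<close> for leaves \<open>j\<close>. The unknowns are the matrices \<open>M a b\<close> for
  \<open>(a, b) \<in> E\<close> and the vectors \<open>\<nu> j\<close>, where \<open>\<nu>\<close> is tied to \<open>\<mu>\<close> at the leaves. Values of \<open>M\<close>
  outside \<open>E\<close> are irrelevant.\<close>

definition SB_objective :: "('v::finite \<times> 'v) set \<Rightarrow> ('v \<Rightarrow> 'v \<Rightarrow> real ^ 'n ^ 'n) \<Rightarrow>
    ('v \<Rightarrow> 'v \<Rightarrow> real ^ 'n ^ 'n) \<times> ('v \<Rightarrow> real ^ 'n::finite) \<Rightarrow> ereal" where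
  "SB_objective E A = (\<lambda>(M, \<nu>). \<Sum>(a, b)\<in>E.
     rel_entropy (\<lambda>(x, y). M a b $ x $ y) (\<lambda>(x, y). (diag (\<nu> a) ** A a b) $ x $ y))"

definition SB_feasible :: "('v::finite \<times> 'v) set \<Rightarrow> ('v \<Rightarrow> real ^ 'n) \<Rightarrow>
    ('v \<Rightarrow> 'v \<Rightarrow> real ^ 'n ^ 'n) \<times> ('v \<Rightarrow> real ^ 'n::finite) \<Rightarrow> bool" where
  "SB_feasible E \<mu> = (\<lambda>(M, \<nu>).
     (\<forall>j \<in> leaves E. \<nu> j = \<mu> j) \<and> (\<forall>j \<in> - leaves E. 0 \<le> \<nu> j) \<and>
     (\<forall>(a, b) \<in> E. 0 \<le> M a b \<and> M a b *v 1 = \<nu> a \<and> transpose (M a b) *v 1 = \<nu> b))"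

definition SB_solution :: "('v::finite \<times> 'v) set \<Rightarrow> ('v \<Rightarrow> 'v \<Rightarrow> real ^ 'n ^ 'n) \<Rightarrow>
    ('v \<Rightarrow> real ^ 'n) \<Rightarrow> ('v \<Rightarrow> 'v \<Rightarrow> real ^ 'n ^ 'n) \<Rightarrow> ('v \<Rightarrow> real ^ 'n::finite) \<Rightarrow> bool" where
  "SB_solution E A \<mu> M \<nu> \<longleftrightarrow> is_arg_min (SB_objective E A) (SB_feasible E \<mu>) (M, \<nu>)"

text \<open>The vectors \<open>v j\<close>, \<open>j\<close> a leaf, represent \<open>(M, \<nu>)\<close>. The equations for \<open>\<phi>\<close> are a recursion
  from the leaves to the root, those for \<open>\<psi>\<close> (usually written \<open>\<phi>\<close> with a hat) from the root to the
  leaves, so both are determined by \<open>v\<close>.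

  If the marginals have positive mass, the divisors \<open>A a b *v \<phi> b\<close> never vanish, and \<open>v r\<close> can
  vanish only at entries where \<open>\<nu> r\<close> does. At such an entry the formula \<open>1 ./ v r\<close> stands for
  \<open>1 / \<infinity> = 0\<close>, which is encoded by the entry 0 of \<open>v r\<close> since \<open>1 / 0 = 0\<close> in HOL.
  For strictly positive \<open>\<nu> r\<close> no division by 0 takes place.\<close>

definition SB_representation :: "('v::finite \<times> 'v) set \<Rightarrow> 'v \<Rightarrow> ('v \<Rightarrow> 'v \<Rightarrow> real ^ 'n ^ 'n) \<Rightarrow>
    ('v \<Rightarrow> 'v \<Rightarrow> real ^ 'n ^ 'n) \<Rightarrow> ('v \<Rightarrow> real ^ 'n) \<Rightarrow> ('v \<Rightarrow> real ^ 'n::finite) \<Rightarrow> bool" where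
  "SB_representation E r A M \<nu> v \<longleftrightarrow> (\<exists>\<phi> \<psi>.
     let \<phi>wo = (\<lambda>a b. \<phi> a ./ (A a b *v \<phi> b)) in
     (\<forall>j. \<phi> j = (if j \<in> leaves E - {r} then v j else (\<Prod>k | (j, k) \<in> E. A j k *v \<phi> k))) \<and>
     \<psi> r = 1 ./ v r \<and>
     (\<forall>j. j \<noteq> r \<longrightarrow>
        \<psi> j = transpose (A (parent E j) j) *v (\<psi> (parent E j) * \<phi>wo (parent E j) j)) \<and>
     (\<forall>j. \<nu> j = \<phi> j * \<psi> j) \<and>
     (\<forall>(a, b) \<in> E. M a b = diag (\<psi> a * \<phi>wo a b) ** A a b ** diag (\<phi> b)))"

text \<open>The leaf vectors of the transport solution that correspond to \<open>v\<close>; all other modes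
  carry the all-ones vector.\<close>

definition MOT_factor :: "('v::finite \<times> 'v) set \<Rightarrow> 'v \<Rightarrow> ('v \<Rightarrow> real ^ 'n) \<Rightarrow> 'v \<Rightarrow> real ^ 'n" where
  "MOT_factor E r v j = (if j \<notin> leaves E then 1 else if j = r then 1 ./ v r else v j)"

end

theory Submission
  imports Defs
begin

text \<open>
  Marginals \<open>M a b\<close>, \<open>\<nu> j\<close> that agree along the tree glue to the Markov tensor
  \<open>S i = \<nu> r (i r) * (\<Prod>(a, b)\<in>E. M a b (i a) (i b) / \<nu> a (i a))\<close>, which has them as projections.
  Let \<open>K\<close> be the kernel tensor. If \<open>T\<close> has the projections \<open>M\<close>, \<open>\<nu>\<close>, then
  \<open>\<Sum>i. T i * ln (S i / K i)\<close> is the bridge cost of \<open>(M, \<nu>)\<close> plus a constant that depends on the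
  root marginal only. Hence \<open>S\<close> has relative entropy (w.r.t. \<open>K\<close>) equal to the bridge cost up to
  this constant, and by Gibbs' inequality \<open>T\<close> has at least that much. So the Markov tensor of the
  bridge solution minimizes the transport problem, and it is the unique minimizer by strict
  convexity.

  When \<open>M\<close>, \<open>\<nu>\<close> are written in terms of \<open>\<phi>\<close>, \<open>\<psi>\<close>, the product defining the Markov tensor
  telescopes to the kernel tensor times the outer product of the leaf vectors. Conversely, the
  recursions started from the \<open>u j\<close> give consistent marginals whose Markov tensor is the transport
  solution, so these are the bridge solution.
\<close>

section \<open>Rooted trees\<close>

lemma simple_path_unique:
  "undirected_tree E \<Longrightarrow> simple_path E a p b \<Longrightarrow> simple_path E a q b \<Longrightarrow> p = q"
  unfolding undirected_tree_def by blast

lemma simple_path_butlast: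
  "simple_path E r (p @ [a, b]) b \<Longrightarrow> simple_path E r (p @ [a]) a"
  by (auto simp: simple_path_def successively_append_iff hd_append split: if_splits)

locale rooted =
  fixes E :: "('v::finite \<times> 'v) set" and r :: 'v
  assumes rooted: "rooted_tree E r"
begin

lemma tree: "undirected_tree E"
  using rooted by (simp add: rooted_tree_def)

lemma edge_path:
  assumes "(a, b) \<in> E" obtains p where "simple_path E r (p @ [a, b]) b"
  using assms rooted unfolding rooted_tree_def by blast

text \<open>Counts vertices rather than edges, so the root has depth 1. It serves as a rank: it
  shows \<open>E\<close> to be well-founded and orders the induction in
  \<open>markov_partial\<close>.\<close>

definition depth :: "'v \<Rightarrow> nat" where
  "depth j = length (THE p. simple_path E r p j)"

lemma depth_eq: "simple_path E r p j \<Longrightarrow> depth j = length p"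
  unfolding depth_def by (metis simple_path_unique the_equality tree)

lemma depth_edge: "(a, b) \<in> E \<Longrightarrow> depth b = Suc (depth a)"
  by (erule edge_path) (use simple_path_butlast depth_eq in fastforce)

lemma no_edge_to_root: "(a, r) \<notin> E"
proof
  assume "(a, r) \<in> E"
  then obtain p where p: "simple_path E r (p @ [a, r]) r" by (rule edge_path)
  moreover have "simple_path E r [r] r" by (simp add: simple_path_def)
  ultimately show False using simple_path_unique[OF tree] by fastforce
qed

text \<open>Either edge would be the last one of the unique path from the root to
  \<open>j\<close>.\<close>

lemma edge_source_unique:
  assumes "(a, j) \<in> E" "(b, j) \<in> E" shows "a = b"
proof -
  obtain p q where "simple_path E r (p @ [a, j]) j" "simple_path E r (q @ [b, j]) j"
    using assms edge_path by metis
  then have "p @ [a, j] = q @ [b, j]" using simple_path_unique[OF tree] by blast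
  then show ?thesis by simp
qed

text \<open>The path from the root to \<open>j\<close> ends in some step from \<open>a\<close> to
  \<open>j\<close>. Were that edge directed from \<open>j\<close> to \<open>a\<close>, the path to
  \<open>a\<close> would run through \<open>j\<close>; but truncating the path to \<open>j\<close>
  already gives a path to \<open>a\<close> that avoids it.\<close>

lemma ex_edge_to:
  assumes "j \<noteq> r" shows "\<exists>a. (a, j) \<in> E"
proof -
  obtain p where p: "simple_path E r p j" using tree unfolding undirected_tree_def by blast
  then obtain q where q: "p = q @ [j]"
    unfolding simple_path_def by (metis append_butlast_last_id)
  then have "q \<noteq> []" using p assms by (auto simp: simple_path_def)
  then obtain s a where s: "p = s @ [a, j]" using q by (metis append_butlast_last_id append.assoc append_Cons append_Nil)
  then have "adj E a j" using p by (auto simp: simple_path_def successively_append_iff)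
  moreover have False if ja: "(j, a) \<in> E"
  proof -
    obtain t where "simple_path E r (t @ [j, a]) a" using edge_path[OF ja] by blast
    moreover have "simple_path E r (s @ [a]) a" using p unfolding s by (rule simple_path_butlast)
    ultimately have "s @ [a] = t @ [j, a]" using simple_path_unique[OF tree] by blast
    then show False using p s by (auto simp: simple_path_def)
  qed
  ultimately show ?thesis by (auto simp: adj_def)
qed

lemma parent_edge: "j \<noteq> r \<Longrightarrow> (parent E j, j) \<in> E"
  unfolding parent_def by (metis edge_source_unique ex_edge_to theI)

lemma parent_eq: "(a, j) \<in> E \<Longrightarrow> parent E j = a"
  using edge_source_unique no_edge_to_root parent_edge by metis

lemma edges_eq: "E = (\<lambda>j. (parent E j, j)) ` (- {r})"
  using parent_edge parent_eq no_edge_to_root by force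

lemma edge_neq: "(a, b) \<in> E \<Longrightarrow> a \<noteq> b"
  using depth_edge by fastforce

text \<open>Recursion along \<open>E\<close> runs from the root to the leaves, as needed for \<psi>;
  its converse, treated next, supports the recursion from the leaves to the root for \<phi>.\<close>

lemma wf_edges: "wf E"
  by (rule wf_subset[OF wf_measure[of depth]]) (auto dest: depth_edge)

lemma wf_edges_converse: "wf (E\<inverse>)"
  by (rule finite_acyclic_wf_converse) (auto simp: wf_acyclic wf_edges)

text \<open>The only neighbour of such a leaf is its parent, and a vertex cannot be both one level
  above and one level below \<open>j\<close>.\<close>

lemma leaf_no_child:
  assumes "j \<in> leaves E" "j \<noteq> r" shows "(j, k) \<notin> E"
proof
  assume k: "(j, k) \<in> E"
  have p: "(parent E j, j) \<in> E" using assms parent_edge by blast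
  obtain z where "{k. adj E j k} = {z}" using assms by (auto simp: leaves_def card_1_singleton_iff)
  moreover have "adj E j k" "adj E j (parent E j)" using k p by (auto simp: adj_def)
  ultimately have "k = parent E j" by (metis mem_Collect_eq singletonD)
  then show False using depth_edge[OF k] depth_edge[OF p] by simp
qed

lemma prod_edges: "(\<Prod>(a, b)\<in>E. f a b) = (\<Prod>j\<in>- {r}. f (parent E j) j)"
proof -
  have "prod (\<lambda>(a, b). f a b) ((\<lambda>j. (parent E j, j)) ` (- {r})) = (\<Prod>j\<in>- {r}. f (parent E j) j)"
    by (subst prod.reindex) (auto intro: inj_onI)
  then show ?thesis using edges_eq by simp
qed

text \<open>Counterpart of \<open>prod_edges\<close>, which groups edges by target. Comparing the
  two groupings makes the product in \<open>telescope\<close> cancel.\<close>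

lemma prod_edges_by_source:
  "(\<Prod>(a, b)\<in>E. f a b) = (\<Prod>a\<in>UNIV. \<Prod>b | (a, b) \<in> E. f a b)"
proof -
  have "E = Sigma UNIV (\<lambda>a. {b. (a, b) \<in> E})" by auto
  then show ?thesis by (subst prod.Sigma) auto
qed

end

section \<open>Projections and Markov tensors\<close>

text \<open>Exchanging \<open>i b\<close> with \<open>y\<close> is an involution on the pairs
  \<open>(i, y)\<close>. After the exchange \<open>y\<close> is idle and contributes the factor
  \<open>CARD('n)\<close>. This is the device for summing out a single mode.\<close>

lemma sum_fun_upd:
  fixes f :: "('v::finite \<Rightarrow> 'n::finite) \<Rightarrow> real"
  shows "(\<Sum>i\<in>UNIV. \<Sum>y\<in>UNIV. f (i(b := y))) = real CARD('n) * (\<Sum>i\<in>UNIV. f i)"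
proof -
  have "bij_betw (\<lambda>(i, y). (i(b := y), i b)) (UNIV :: (('v \<Rightarrow> 'n) \<times> 'n) set) UNIV"
    by (rule bij_betwI[where g = "\<lambda>(i, y). (i(b := y), i b)"]) auto
  from sum.reindex_bij_betw[OF this, of "\<lambda>(i, y). f i"]
  have "(\<Sum>(i, y)\<in>UNIV. f (i(b := y))) = (\<Sum>(i, y)\<in>(UNIV :: (('v \<Rightarrow> 'n) \<times> 'n) set). f i)"
    by (simp add: case_prod_unfold)
  then show ?thesis
    by (simp add: UNIV_Times_UNIV[symmetric] sum.cartesian_product[symmetric] sum_distrib_left
             del: UNIV_Times_UNIV)
qed

lemma card_fixed_coordinate:
  "card {i :: 'v::finite \<Rightarrow> 'n::finite. i r = x} = CARD('n) ^ card (- {r})"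
proof -
  have "{i :: 'v \<Rightarrow> 'n. i r = x} = PiE UNIV (\<lambda>j. if j = r then {x} else UNIV)"
    by (auto simp: PiE_def Pi_def extensional_def split: if_splits)
  also have "card \<dots> = (\<Prod>j\<in>UNIV. if j = r then 1 else CARD('n))"
    by (auto simp: card_PiE intro!: prod.cong)
  also have "\<dots> = (\<Prod>j\<in>-{r}. CARD('n))"
    by (rule prod.mono_neutral_cong_right) auto
  finally show ?thesis by simp
qed

text \<open>Grouping the index families by their value at \<open>a\<close>: a sum against a function
  of one mode depends on the projection alone.\<close>

lemma sum_proj:
  "(\<Sum>i\<in>UNIV. T $ i * g (i a)) = (\<Sum>x\<in>UNIV. proj a T $ x * g x)"
proof -
  have "(\<Sum>x\<in>UNIV. proj a T $ x * g x) = (\<Sum>x\<in>UNIV. \<Sum>i | i \<in> UNIV \<and> i a = x. T $ i * g (i a))"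
    by (auto simp: proj_def sum_distrib_right intro!: sum.cong)
  also have "\<dots> = (\<Sum>i\<in>UNIV. T $ i * g (i a))"
    by (rule sum.group) auto
  finally show ?thesis by simp
qed

lemma sum_proj2:
  "(\<Sum>i\<in>UNIV. T $ i * g (i a) (i b)) = (\<Sum>x\<in>UNIV. \<Sum>y\<in>UNIV. proj2 a b T $ x $ y * g x y)"
proof -
  have "(\<Sum>x\<in>UNIV. \<Sum>y\<in>UNIV. proj2 a b T $ x $ y * g x y) =
    (\<Sum>(x, y)\<in>UNIV. \<Sum>i | i \<in> UNIV \<and> (i a, i b) = (x, y). T $ i * g (i a) (i b))"
    by (auto simp: proj2_def sum_distrib_right sum.cartesian_product intro!: sum.cong)
  also have "\<dots> = (\<Sum>i\<in>UNIV. T $ i * g (i a) (i b))"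
    unfolding case_prod_unfold prod.collapse
    by (rule sum.group) auto
  finally show ?thesis by simp
qed

text \<open>Both grouping rules are tested with the indicator of \<open>x\<close> at mode
  \<open>a\<close>.\<close>

lemma sum_proj2_right: "(\<Sum>y\<in>UNIV. proj2 a b T $ x $ y) = proj a T $ x"
  using sum_proj2[of T "\<lambda>s t. of_bool (s = x)" a b] sum_proj[of T "\<lambda>s. of_bool (s = x)" a]
  by (simp add: of_bool_def if_distrib cong: if_cong)
   (simp add: sum.swap[where A = UNIV and B = UNIV])

lemma sum_proj2_left: "(\<Sum>x\<in>UNIV. proj2 a b T $ x $ y) = proj b T $ y"
  using sum_proj2[of T "\<lambda>s t. of_bool (t = y)" a b] sum_proj[of T "\<lambda>s. of_bool (s = y)" b]
  by (simp add: of_bool_def if_distrib cong: if_cong)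

lemma sum_proj_UNIV: "(\<Sum>x\<in>UNIV. proj a T $ x) = (\<Sum>i\<in>UNIV. T $ i)"
  using sum_proj[of T "\<lambda>_. 1" a] by simp

text \<open>The law, of arbitrary total mass, of a Markov chain indexed by the tree: it starts from
  \<open>\<nu> r\<close> and uses the normalized rows of \<open>M a b\<close> as transitions along
  the edges.\<close>

definition markov_tensor :: "('v::finite \<times> 'v) set \<Rightarrow> 'v \<Rightarrow> ('v \<Rightarrow> 'v \<Rightarrow> real ^ 'n ^ 'n) \<Rightarrow>
    ('v \<Rightarrow> real ^ 'n) \<Rightarrow> real ^ ('v \<Rightarrow> 'n::finite)" where
  "markov_tensor E r M \<nu> =
     (\<chi> i. \<nu> r $ i r * (\<Prod>(a, b)\<in>E. M a b $ i a $ i b / \<nu> a $ i a))"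

text \<open>The last clause makes the divisions by \<open>\<nu> a\<close> in \<^const>\<open>markov_tensor\<close> harmless
  without any sign condition on \<open>M\<close>.\<close>

definition consistent :: "('v \<times> 'v) set \<Rightarrow> ('v \<Rightarrow> 'v \<Rightarrow> real ^ 'n ^ 'n) \<Rightarrow>
    ('v \<Rightarrow> real ^ 'n::finite) \<Rightarrow> bool" where
  "consistent E M \<nu> \<longleftrightarrow> (\<forall>(a, b)\<in>E. \<forall>x y.
     (\<Sum>y\<in>UNIV. M a b $ x $ y) = \<nu> a $ x \<and> (\<Sum>x\<in>UNIV. M a b $ x $ y) = \<nu> b $ y \<and>
     (\<nu> a $ x = 0 \<or> \<nu> b $ y = 0 \<longrightarrow> M a b $ x $ y = 0))"

section \<open>Marginals of the Markov tensor\<close>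

context rooted
begin

text \<open>Sums run over all index families, so every mode that is not yet attached to the tree
  contributes a factor \<open>CARD('n)\<close>; the factors \<open>CARD('n)\<close> in \<open>G\<close> make up for those that disappear.\<close>

lemma markov_partial:
  fixes M :: "'v \<Rightarrow> 'v \<Rightarrow> real ^ 'n ^ 'n::finite" and \<nu> :: "'v \<Rightarrow> real ^ 'n"
    and S :: "'v set"
  defines "G \<equiv> \<lambda>S i. \<nu> r $ i r * (\<Prod>b\<in>S. real CARD('n) *
      (M (parent E b) b $ i (parent E b) $ i b / \<nu> (parent E b) $ i (parent E b)))"
    and "N \<equiv> real CARD('n) ^ card (- {r})"
  assumes cons: "consistent E M \<nu>"
    and S: "r \<notin> S" "\<forall>b\<in>S. parent E b \<in> insert r S"
  shows "(\<forall>a\<in>insert r S. \<forall>x. (\<Sum>i\<in>UNIV. of_bool (i a = x) * G S i) = N * \<nu> a $ x) \<and>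
    (\<forall>b\<in>S. \<forall>x y. (\<Sum>i\<in>UNIV. of_bool (i (parent E b) = x \<and> i b = y) * G S i) =
       N * M (parent E b) b $ x $ y)"
proof -
  have "finite S" by simp
  from this S show ?thesis
  \<comment> \<open>Vertices are added in order of increasing depth, so the new vertex
    \<open>b\<close> is not the parent of any vertex of \<open>S\<close>. The induction rule allows
    \<open>b\<close> to lie in \<open>S\<close> already, whence the later case distinction.\<close>
  proof (induction S rule: finite_ranking_induct[where f = depth])
    case empty
    have "(\<Sum>i\<in>UNIV. of_bool (i r = x) * G {} i) = N * \<nu> r $ x" for x
    proof -
      have "(\<Sum>i\<in>UNIV. of_bool (i r = x) * G {} i) = (\<Sum>i | i r = x. \<nu> r $ x)"
        by (rule sum.mono_neutral_cong_right) (auto simp: G_def)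
      then show ?thesis by (simp add: N_def card_fixed_coordinate)
    qed
    then show ?case by simp
  next
    case (insert b S)
    define a where "a = parent E b"
    define q where "q x y = M a b $ x $ y / \<nu> a $ x" for x y
    have br: "b \<noteq> r" and rS: "r \<notin> S" using insert.prems by auto
    have ab: "(a, b) \<in> E" using br parent_edge a_def by simp
    have aS: "a \<in> insert r S" using insert.prems(2) edge_neq[OF ab] by (auto simp: a_def)
    have pnb: "parent E c \<noteq> b" if "c \<in> S" for c
    proof -
      have "(parent E c, c) \<in> E" using that rS parent_edge by metis
      from depth_edge[OF this] show ?thesis using insert.hyps(2)[OF that] by auto
    qed
    have "\<forall>c\<in>S. parent E c \<in> insert r S" using insert.prems(2) pnb by blast
    with insert.IH rS have IH: "\<And>c x. c \<in> insert r S \<Longrightarrow>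
         (\<Sum>i\<in>UNIV. of_bool (i c = x) * G S i) = N * \<nu> c $ x"
      "\<And>c x y. c \<in> S \<Longrightarrow> (\<Sum>i\<in>UNIV. of_bool (i (parent E c) = x \<and> i c = y) * G S i) =
       N * M (parent E c) c $ x $ y" by blast+
    have z: "M c d $ x $ y = 0" if "(c, d) \<in> E" "\<nu> c $ x = 0 \<or> \<nu> d $ y = 0" for c d x y
      using cons that unfolding consistent_def by fast
    have rows: "(\<Sum>y\<in>UNIV. M c d $ x $ y) = \<nu> c $ x"
      and cols: "(\<Sum>x\<in>UNIV. M c d $ x $ y) = \<nu> d $ y" if "(c, d) \<in> E" for c d x y
      using cons that unfolding consistent_def by fast+
    show ?case
    proof (cases "b \<in> S")
      case True
      then show ?thesis using IH by (simp add: insert_absorb)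
    next
      case False
      have G_ins: "G (insert b S) i = real CARD('n) * q (i a) (i b) * G S i" for i
        using False by (simp add: G_def a_def[symmetric] q_def)
      have G_upd: "G S (i(b := y)) = G S i" for i y
        using False br pnb by (auto simp: G_def intro!: prod.cong)
      \<comment> \<open>Transition rows sum to 1 except where \<open>\<nu> a\<close> vanishes. There
        the row is zero, but so is \<open>G S i\<close>, through the root factor or through the
        factor of the edge into \<open>a\<close>.\<close>
      have q_sum: "(\<Sum>y\<in>UNIV. q (i a) y) * G S i = G S i" for i
      proof (cases "\<nu> a $ i a = 0")
        case True
        have "G S i = 0"
        proof (cases "a = r")
          case True
          then show ?thesis using \<open>\<nu> a $ i a = 0\<close> by (simp add: G_def)
        next
          case False
          then have "a \<in> S" "(parent E a, a) \<in> E" using aS parent_edge by auto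
          then show ?thesis using z[OF _ disjI2[OF True]] by (auto simp: G_def)
        qed
        then show ?thesis by simp
      next
        case False
        then show ?thesis using rows[OF ab] by (simp add: q_def sum_divide_distrib[symmetric])
      qed
      \<comment> \<open>The coordinate \<open>b\<close> is resampled as \<open>y\<close>. Neither
        \<open>G S\<close> nor \<open>i a\<close> reads it, and the factor \<open>CARD('n)\<close>
        in \<open>G\<close> pays for the idle coordinate.\<close>
      have step: "(\<Sum>i\<in>UNIV. h i * G (insert b S) i) =
          (\<Sum>i\<in>UNIV. \<Sum>y\<in>UNIV. h (i(b := y)) * q (i a) y * G S i)" for h
        using sum_fun_upd[of "\<lambda>i. h i * q (i a) (i b) * G S i" b] edge_neq[OF ab]
        by (simp add: G_ins G_upd sum_distrib_left mult_ac)
      \<comment> \<open>Test functions that ignore the new mode keep their sums, so the marginals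
        found earlier persist.\<close>
      have old: "(\<Sum>i\<in>UNIV. h i * G (insert b S) i) = (\<Sum>i\<in>UNIV. h i * G S i)"
        if "\<And>i y. h (i(b := y)) = h i" for h
      proof -
        have "(\<Sum>y\<in>UNIV. h i * q (i a) y * G S i) = h i * G S i" for i
          using arg_cong[OF q_sum[of i], of "\<lambda>t. h i * t"]
          by (simp add: sum_distrib_left sum_distrib_right mult_ac)
        then show ?thesis by (simp add: step that)
      qed
      have new: "(\<Sum>i\<in>UNIV. of_bool (i a = x \<and> i b = y) * G (insert b S) i) = N * M a b $ x $ y"
        for x y
      proof -
        have "(\<Sum>t\<in>UNIV. of_bool ((i(b := t)) a = x \<and> (i(b := t)) b = y) * q (i a) t * G S i)
            = q x y * (of_bool (i a = x) * G S i)" for i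
        proof -
          have "(\<Sum>t\<in>UNIV. of_bool ((i(b := t)) a = x \<and> (i(b := t)) b = y) * q (i a) t * G S i)
            = (\<Sum>t\<in>UNIV. if t = y then of_bool (i a = x) * q (i a) y * G S i else 0)"
            using edge_neq[OF ab] by (intro sum.cong) auto
          then show ?thesis by simp
        qed
        then have "(\<Sum>i\<in>UNIV. of_bool (i a = x \<and> i b = y) * G (insert b S) i) =
           q x y * (N * \<nu> a $ x)"
          unfolding step using IH(1)[OF aS] by (simp add: sum_distrib_left[symmetric])
        also have "\<dots> = N * M a b $ x $ y" using z[OF ab] by (auto simp: q_def)
        finally show ?thesis .
      qed
      \<comment> \<open>The marginal at \<open>b\<close> consists of the column sums of the pair
        marginal just computed.\<close>
      have newb: "(\<Sum>i\<in>UNIV. of_bool (i b = y) * G (insert b S) i) = N * \<nu> b $ y" for y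
      proof -
        have "N * \<nu> b $ y = (\<Sum>x\<in>UNIV. N * M a b $ x $ y)"
          by (simp add: sum_distrib_left[symmetric] cols[OF ab])
        also have "\<dots> = (\<Sum>i\<in>UNIV. \<Sum>x\<in>UNIV. of_bool (i a = x \<and> i b = y) * G (insert b S) i)"
          by (subst sum.swap) (simp add: new)
        also have "\<dots> = (\<Sum>i\<in>UNIV. of_bool (i b = y) * G (insert b S) i)"
        proof (rule sum.cong[OF refl])
          fix i
          have "(\<Sum>x\<in>UNIV. of_bool (i a = x \<and> i b = y) * G (insert b S) i) =
            (\<Sum>x\<in>UNIV. if x = i a then of_bool (i b = y) * G (insert b S) i else 0)"
            by (intro sum.cong) auto
          then show "(\<Sum>x\<in>UNIV. of_bool (i a = x \<and> i b = y) * G (insert b S) i) =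
            of_bool (i b = y) * G (insert b S) i" by simp
        qed
        finally show ?thesis ..
      qed
      have "(\<Sum>i\<in>UNIV. of_bool (i c = x) * G (insert b S) i) = N * \<nu> c $ x"
        if "c \<in> insert r (insert b S)" for c x
      proof (cases "c = b")
        case True
        then show ?thesis using newb by simp
      next
        case False
        then show ?thesis using that IH(1)[of c x] by (subst old) auto
      qed
      moreover have "(\<Sum>i\<in>UNIV. of_bool (i (parent E c) = x \<and> i c = y) * G (insert b S) i) =
         N * M (parent E c) c $ x $ y" if "c \<in> insert b S" for c x y
      proof (cases "c = b")
        case True
        then show ?thesis using new by (simp add: a_def)
      next
        case False
        then show ?thesis using that IH(2)[of c x y] pnb by (subst old) auto
      qed
      ultimately show ?thesis by blast
    qed
  qed
qed

text \<open>This is \<open>markov_partial\<close> for \<open>S = - {r}\<close>, where the product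
  runs over all edges. The factors \<open>CARD('n)\<close> multiply to \<open>N\<close>, which
  cancels.\<close>

lemma markov_proj:
  fixes M :: "'v \<Rightarrow> 'v \<Rightarrow> real ^ 'n ^ 'n::finite"
  assumes cons: "consistent E M \<nu>"
  shows "proj a (markov_tensor E r M \<nu>) = \<nu> a"
    and "(a, b) \<in> E \<Longrightarrow> proj2 a b (markov_tensor E r M \<nu>) = M a b"
proof -
  define N where "N = real CARD('n) ^ card (- {r})"
  have N: "N > 0" by (simp add: N_def)
  have G: "\<nu> r $ i r * (\<Prod>b\<in>- {r}. real CARD('n) *
      (M (parent E b) b $ i (parent E b) $ i b / \<nu> (parent E b) $ i (parent E b))) =
    N * markov_tensor E r M \<nu> $ i" for i
    by (simp add: markov_tensor_def prod_edges prod.distrib N_def del: times_divide_eq_right)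
  note P = markov_partial[OF cons, of "- {r}", unfolded G, folded N_def]
  have "N * proj a (markov_tensor E r M \<nu>) $ x = N * \<nu> a $ x" for x
  proof -
    have "N * proj a (markov_tensor E r M \<nu>) $ x =
        (\<Sum>i\<in>UNIV. of_bool (i a = x) * (N * markov_tensor E r M \<nu> $ i))"
      by (auto simp: proj_def sum_distrib_left intro!: sum.mono_neutral_cong_left)
    then show ?thesis using P by auto
  qed
  then show "proj a (markov_tensor E r M \<nu>) = \<nu> a" using N by (simp add: vec_eq_iff)
  assume ab: "(a, b) \<in> E"
  have "N * proj2 a b (markov_tensor E r M \<nu>) $ x $ y = N * M a b $ x $ y" for x y
  proof -
    have "N * proj2 a b (markov_tensor E r M \<nu>) $ x $ y =
        (\<Sum>i\<in>UNIV. of_bool (i a = x \<and> i b = y) * (N * markov_tensor E r M \<nu> $ i))"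
      by (auto simp: proj2_def sum_distrib_left intro!: sum.mono_neutral_cong_left)
    then show ?thesis using P parent_eq[OF ab] ab no_edge_to_root by (cases "b = r") auto
  qed
  then show "proj2 a b (markov_tensor E r M \<nu>) = M a b" using N by (simp add: vec_eq_iff)
qed

end

section \<open>Entropy\<close>

text \<open>Relative entropy stripped of its linear terms, which are constant once the masses are
  fixed. It agrees with the extended-real notion only if \<open>p\<close> vanishes wherever
  \<open>q\<close> does.\<close>

definition kl :: "('i::finite \<Rightarrow> real) \<Rightarrow> ('i \<Rightarrow> real) \<Rightarrow> real" where
  "kl p q = (\<Sum>i\<in>UNIV. p i * ln (p i / q i))"

lemma rel_entropy_eq:
  assumes "\<And>i. q i = 0 \<Longrightarrow> p i = 0"
  shows "rel_entropy p q = ereal (kl p q - sum p UNIV + sum q UNIV)"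
proof -
  have "rel_entropy p q = (\<Sum>i\<in>UNIV. ereal (p i * ln (p i / q i) - p i + q i))"
    unfolding rel_entropy_def using assms by (intro sum.cong) auto
  then show ?thesis by (simp add: sum_ereal sum.distrib sum_subtractf kl_def)
qed

text \<open>This is \<open>ln z \<le> z - 1\<close> at \<open>z = s / t\<close>, with equality only
  at \<open>z = 1\<close>.\<close>

lemma diff_le_mult_ln_divide:
  fixes t s :: real
  assumes "0 \<le> t" "0 \<le> s" "s = 0 \<Longrightarrow> t = 0"
  shows "t - s \<le> t * ln (t / s)"
    and "t * ln (t / s) = t - s \<Longrightarrow> t = s"
proof -
  have "t - s \<le> t * ln (t / s) \<and> (t * ln (t / s) = t - s \<longrightarrow> t = s)"
  proof (cases "t = 0")
    case False
    then have pos: "t > 0" "s > 0" using assms by (auto simp: less_le)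
    have ln: "ln (t / s) = - ln (s / t)" using pos by (simp add: ln_div)
    have "t * ln (s / t) \<le> t * (s / t - 1)"
      using pos by (intro mult_left_mono ln_le_minus_one) auto
    moreover have "t * (s / t - 1) = s - t" using pos by (simp add: field_simps)
    moreover have "t = s" if "t * ln (s / t) = s - t"
    proof -
      have "ln (s / t) = s / t - 1" using that pos by (simp add: field_simps)
      then have "s / t = 1" using pos by (intro ln_eq_minus_one) auto
      then show ?thesis using pos by simp
    qed
    ultimately show ?thesis unfolding ln by auto
  qed (use assms in auto)
  then show "t - s \<le> t * ln (t / s)" "t * ln (t / s) = t - s \<Longrightarrow> t = s" by auto
qed

text \<open>Gibbs' inequality with a reference \<open>k\<close> that cancels: the difference of the
  two sides is the divergence of \<open>p\<close> from \<open>q\<close>. Equal masses allow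
  \<open>p i - q i\<close> to be subtracted from each term, which makes every term
  nonnegative.\<close>

lemma cross_entropy_le_kl:
  assumes nonneg: "\<And>i. 0 \<le> p i" "\<And>i. 0 \<le> q i" and k: "\<And>i. 0 < k i"
    and ac: "\<And>i. q i = 0 \<Longrightarrow> p i = 0" and mass: "sum p UNIV = sum q UNIV"
  shows "(\<Sum>i\<in>UNIV. p i * ln (q i / k i)) \<le> kl p k"
    and "(\<Sum>i\<in>UNIV. p i * ln (q i / k i)) = kl p k \<Longrightarrow> p = q"
proof -
  define f where "f i = p i * ln (p i / q i) - (p i - q i)" for i
  have f: "0 \<le> f i" "f i = 0 \<Longrightarrow> p i = q i" for i
    using diff_le_mult_ln_divide[of "p i" "q i"] nonneg ac by (auto simp: f_def)
  have "p i * ln (p i / k i) - p i * ln (q i / k i) = p i * ln (p i / q i)" for i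
    using nonneg[of i] k[of i] ac[of i] by (cases "p i = 0") (auto simp: ln_div algebra_simps)
  then have "kl p k - (\<Sum>i\<in>UNIV. p i * ln (q i / k i)) = sum f UNIV"
    using mass by (simp add: kl_def f_def sum_subtractf[symmetric])
     (simp add: sum_subtractf)
  moreover have "sum f UNIV \<ge> 0" using f by (intro sum_nonneg) auto
  moreover have "p = q" if "sum f UNIV = 0"
    using that f sum_nonneg_eq_0_iff[of UNIV f] by auto
  ultimately show "(\<Sum>i\<in>UNIV. p i * ln (q i / k i)) \<le> kl p k"
    "(\<Sum>i\<in>UNIV. p i * ln (q i / k i)) = kl p k \<Longrightarrow> p = q" by auto
qed

text \<open>Gibbs' inequality is applied to \<open>p\<close> and to \<open>q\<close>, each against
  their midpoint. The two cross entropies add up to twice the divergence of the midpoint, and the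
  inequality for \<open>p\<close> is strict.\<close>

lemma kl_strictly_midconvex:
  assumes nonneg: "\<And>i. 0 \<le> p i" "\<And>i. 0 \<le> q i" and k: "\<And>i. 0 < k i"
    and mass: "sum p UNIV = sum q UNIV" and "p \<noteq> q"
  shows "2 * kl (\<lambda>i. (p i + q i) / 2) k < kl p k + kl q k"
proof -
  let ?m = "\<lambda>i. (p i + q i) / 2"
  have m: "0 \<le> ?m i" "?m i = 0 \<Longrightarrow> p i = 0" "?m i = 0 \<Longrightarrow> q i = 0" for i
    using nonneg[of i] by auto
  have sm: "sum p UNIV = sum ?m UNIV" "sum q UNIV = sum ?m UNIV"
    using mass by (simp_all add: sum_divide_distrib[symmetric] sum.distrib)
  have "p \<noteq> ?m"
  proof
    assume "p = ?m"
    then have "\<And>i. p i = (p i + q i) / 2" by meson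
    then have "p = q" by (auto simp: field_simps)
    then show False using \<open>p \<noteq> q\<close> by simp
  qed
  then have "(\<Sum>i\<in>UNIV. p i * ln (?m i / k i)) < kl p k"
    using cross_entropy_le_kl[of p ?m k, OF nonneg(1) m(1) k m(2) sm(1)] by fastforce
  moreover have "(\<Sum>i\<in>UNIV. q i * ln (?m i / k i)) \<le> kl q k"
    using cross_entropy_le_kl(1)[of q ?m k, OF nonneg(2) m(1) k m(3) sm(2)] .
  moreover have "2 * kl ?m k = (\<Sum>i\<in>UNIV. p i * ln (?m i / k i)) + (\<Sum>i\<in>UNIV. q i * ln (?m i / k i))"
    unfolding kl_def sum_distrib_left sum.distrib[symmetric]
    by (intro sum.cong) (auto simp: algebra_simps)
  ultimately show ?thesis by simp
qed

section \<open>The transport objective as a relative entropy\<close>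

lemma kernel_tensor_cong:
  "(\<And>a b. (a, b) \<in> E \<Longrightarrow> K a b = L a b) \<Longrightarrow> kernel_tensor E K = kernel_tensor E L"
  unfolding kernel_tensor_def vec_eq_iff by (auto intro!: prod.cong)

lemma kernel_tensor_pos:
  "(\<And>a b x y. (a, b) \<in> E \<Longrightarrow> 0 < K a b $ x $ y) \<Longrightarrow> 0 < kernel_tensor E K $ i"
  by (auto simp: kernel_tensor_def intro!: prod_pos)

lemma gibbs_pos: "0 < gibbs \<epsilon> C $ x $ y"
  by (simp add: gibbs_def)

text \<open>The cost tensor is \<open>- \<epsilon>\<close> times the logarithm of the kernel, so the
  linear cost merges with the entropy. The final constant is the mass of the all-ones
  tensor.\<close>

lemma MOT_objective_eq:
  fixes E :: "('v::finite \<times> 'v) set" and T :: "real ^ ('v \<Rightarrow> 'n::finite)"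
    and C :: "'v \<Rightarrow> 'v \<Rightarrow> real ^ 'n ^ 'n"
  assumes "\<epsilon> > 0"
  defines "K \<equiv> kernel_tensor E (\<lambda>a b. gibbs \<epsilon> (C a b))"
  shows "MOT_objective E C \<epsilon> T =
    ereal (\<epsilon> * (kl (\<lambda>i. T $ i) (\<lambda>i. K $ i) - (\<Sum>i\<in>UNIV. T $ i) + real CARD('v \<Rightarrow> 'n)))"
proof -
  have c: "cost_tensor E C $ i = - \<epsilon> * ln (K $ i)" for i
  proof -
    have "ln (K $ i) = (\<Sum>(a, b)\<in>E. - C a b $ i a $ i b / \<epsilon>)"
      unfolding K_def kernel_tensor_def
      by (auto simp: ln_prod gibbs_def case_prod_unfold)
    then show ?thesis
      using \<open>\<epsilon> > 0\<close> by (auto simp: cost_tensor_def sum_distrib_left case_prod_unfold)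
  qed
  have K: "K $ i > 0" for i unfolding K_def by (rule kernel_tensor_pos) (rule gibbs_pos)
  have "cost_tensor E C \<bullet> T + \<epsilon> * kl (\<lambda>i. T $ i) (\<lambda>_. 1) = \<epsilon> * kl (\<lambda>i. T $ i) (\<lambda>i. K $ i)"
    unfolding kl_def inner_vec_def sum_distrib_left sum.distrib[symmetric]
  proof (rule sum.cong[OF refl])
    fix i
    show "cost_tensor E C $ i \<bullet> T $ i + \<epsilon> * (T $ i * ln (T $ i / 1)) =
         \<epsilon> * (T $ i * ln (T $ i / K $ i))"
      using K[of i] by (cases "T $ i = 0") (auto simp: c ln_div algebra_simps)
  qed
  then show ?thesis unfolding MOT_objective_def
    by (subst rel_entropy_eq) (auto simp: algebra_simps)
qed

section \<open>The bridge objective on feasible points\<close>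

definition bridge_cost :: "('v \<times> 'v) set \<Rightarrow> ('v \<Rightarrow> 'v \<Rightarrow> real ^ 'n ^ 'n) \<Rightarrow>
    ('v \<Rightarrow> 'v \<Rightarrow> real ^ 'n ^ 'n) \<Rightarrow> ('v \<Rightarrow> real ^ 'n::finite) \<Rightarrow> real" where
  "bridge_cost E A M \<nu> = (\<Sum>(a, b)\<in>E. \<Sum>x\<in>UNIV. \<Sum>y\<in>UNIV.
     M a b $ x $ y * ln (M a b $ x $ y / (\<nu> a $ x * A a b $ x $ y)))"

lemma mult_vec_one: "(M *v 1) $ x = (\<Sum>y\<in>UNIV. M $ x $ y)" for M :: "real ^ 'n ^ 'm"
  by (simp add: matrix_vector_mult_def)

lemma transpose_mult_vec_one: "(transpose M *v 1) $ y = (\<Sum>x\<in>UNIV. M $ x $ y)"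
  for M :: "real ^ 'n ^ 'm"
  by (simp add: matrix_vector_mult_def transpose_def del: transpose_matrix_vector)

lemma diag_mult: "(diag d ** M) $ x $ y = d $ x * M $ x $ y"
  by (simp add: matrix_matrix_mult_def diag_def if_distrib[of "\<lambda>t. t * _"] cong: if_cong)

lemma mult_diag: "(M ** diag d) $ x $ y = M $ x $ y * d $ y"
  by (simp add: matrix_matrix_mult_def diag_def if_distrib cong: if_cong)

lemma sum_UNIV_pair:
  "(\<Sum>z\<in>UNIV. f z) = (\<Sum>x\<in>(UNIV :: 'a::finite set). \<Sum>y\<in>(UNIV :: 'b::finite set). f (x, y))"
  by (simp add: sum.cartesian_product)

text \<open>Nonnegative entries with vanishing row or column sum must all vanish, which gives the
  last clause of \<open>consistent\<close>.\<close>

lemma SB_feasible_consistent: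
  assumes "SB_feasible E \<mu> (M, \<nu>)"
  shows "consistent E M \<nu>"
  unfolding consistent_def
proof (clarify)
  fix a b x y assume ab: "(a, b) \<in> E"
  have nn: "0 \<le> M a b $ x $ y" for x y
    using assms ab by (auto simp: SB_feasible_def less_eq_vec_def)
  have "M a b *v 1 = \<nu> a" "transpose (M a b) *v 1 = \<nu> b"
    using assms ab by (auto simp: SB_feasible_def)
  then have sums: "(\<Sum>y\<in>UNIV. M a b $ x $ y) = \<nu> a $ x" "(\<Sum>x\<in>UNIV. M a b $ x $ y) = \<nu> b $ y"
    for x y by (metis mult_vec_one, metis transpose_mult_vec_one)
  have "M a b $ x $ y = 0" if "\<nu> a $ x = 0 \<or> \<nu> b $ y = 0"
    using that nn sums(1)[of x] sums(2)[of y] sum_nonneg_eq_0_iff[of UNIV "\<lambda>y. M a b $ x $ y"]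
     sum_nonneg_eq_0_iff[of UNIV "\<lambda>x. M a b $ x $ y"] by auto
  with sums show "(\<Sum>y\<in>UNIV. M a b $ x $ y) = \<nu> a $ x \<and> (\<Sum>x\<in>UNIV. M a b $ x $ y) = \<nu> b $ y \<and>
     (\<nu> a $ x = 0 \<or> \<nu> b $ y = 0 \<longrightarrow> M a b $ x $ y = 0)" by blast
qed

lemma consistentD:
  assumes "consistent E M \<nu>" "(a, b) \<in> E"
  shows "(\<Sum>y\<in>UNIV. M a b $ x $ y) = \<nu> a $ x" "(\<Sum>x\<in>UNIV. M a b $ x $ y) = \<nu> b $ y"
    "\<nu> a $ x = 0 \<Longrightarrow> M a b $ x $ y = 0" "\<nu> b $ y = 0 \<Longrightarrow> M a b $ x $ y = 0"
  using assms unfolding consistent_def by fast+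

text \<open>Since \<open>A a b\<close> is row-stochastic, \<open>diag (\<nu> a) ** A a b\<close> has
  the same row sums as \<open>M a b\<close>, and the linear terms of the entropy cancel. The value
  is finite because \<open>A a b\<close> is positive and \<open>M a b\<close> vanishes on the rows
  where \<open>\<nu> a\<close> does.\<close>

lemma SB_objective_eq:
  assumes feas: "SB_feasible E \<mu> (M, \<nu>)"
    and A: "\<And>a b. (a, b) \<in> E \<Longrightarrow> row_stochastic (A a b)"
      "\<And>a b x y. (a, b) \<in> E \<Longrightarrow> 0 < A a b $ x $ y"
  shows "SB_objective E A (M, \<nu>) = ereal (bridge_cost E A M \<nu>)"
proof -
  have "rel_entropy (\<lambda>(x, y). M a b $ x $ y) (\<lambda>(x, y). (diag (\<nu> a) ** A a b) $ x $ y) =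
    ereal (\<Sum>x\<in>UNIV. \<Sum>y\<in>UNIV. M a b $ x $ y * ln (M a b $ x $ y / (\<nu> a $ x * A a b $ x $ y)))"
    if ab: "(a, b) \<in> E" for a b
  proof -
    note cons = consistentD[OF SB_feasible_consistent[OF feas] ab]
    have "(\<Sum>y\<in>UNIV. A a b $ x $ y) = 1" for x
      using A(1)[OF ab] unfolding row_stochastic_def
      by (metis mult_vec_one one_index)
    then have "(\<Sum>y\<in>UNIV. \<nu> a $ x * A a b $ x $ y) = \<nu> a $ x" for x
      by (simp add: sum_distrib_left[symmetric])
    then show ?thesis
      using cons(1,3) A(2)[OF ab]
      by (subst rel_entropy_eq) (auto simp: diag_mult sum_UNIV_pair kl_def less_le)
  qed
  then have "SB_objective E A (M, \<nu>) = (\<Sum>e\<in>E. ereal ((\<lambda>(a, b). \<Sum>x\<in>UNIV. \<Sum>y\<in>UNIV.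
     M a b $ x $ y * ln (M a b $ x $ y / (\<nu> a $ x * A a b $ x $ y))) e))"
    unfolding SB_objective_def prod.case by (intro sum.cong) auto
  then show ?thesis by (simp add: bridge_cost_def sum_ereal)
qed

section \<open>Transport plans and their projections\<close>

lemma proj_nonneg: "0 \<le> T \<Longrightarrow> 0 \<le> proj j T"
  by (auto simp: proj_def less_eq_vec_def intro: sum_nonneg)

lemma proj2_nonneg: "0 \<le> T \<Longrightarrow> 0 \<le> proj2 j k T"
  by (auto simp: proj2_def less_eq_vec_def intro: sum_nonneg)

lemma tensor_le_proj: "0 \<le> T \<Longrightarrow> T $ i \<le> proj j T $ i j"
  unfolding proj_def by (auto simp: less_eq_vec_def intro!: member_le_sum)

lemma tensor_le_proj2: "0 \<le> T \<Longrightarrow> T $ i \<le> proj2 j k T $ i j $ i k"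
  unfolding proj2_def by (auto simp: less_eq_vec_def intro!: member_le_sum)

lemma proj2_mult_one: "proj2 a b T *v 1 = proj a T"
  by (simp add: vec_eq_iff mult_vec_one sum_proj2_right)

lemma transpose_proj2_mult_one: "transpose (proj2 a b T) *v 1 = proj b T"
  unfolding vec_eq_iff transpose_mult_vec_one sum_proj2_left by simp

lemma SB_feasible_proj:
  assumes "MOT_feasible E \<mu> T"
  shows "SB_feasible E \<mu> (\<lambda>a b. proj2 a b T, \<lambda>j. proj j T)"
  using assms
  by (auto simp: SB_feasible_def MOT_feasible_def proj_nonneg proj2_nonneg proj2_mult_one
    transpose_proj2_mult_one simp del: transpose_matrix_vector)

text \<open>Where \<open>T\<close> is nonzero, all its marginals are positive, so the logarithm
  splits into a root term and one term per edge. Each term reads one or two modes, hence its sum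
  against \<open>T\<close> depends only on the projections.\<close>

lemma
  fixes T :: "real ^ ('v::finite \<Rightarrow> 'n::finite)"
  assumes T: "0 \<le> T"
    and proj: "\<And>j. proj j T = \<nu> j" "\<And>a b. (a, b) \<in> E \<Longrightarrow> proj2 a b T = M a b"
    and A: "\<And>a b x y. (a, b) \<in> E \<Longrightarrow> 0 < A a b $ x $ y"
  shows markov_tensor_abs_cont: "markov_tensor E r M \<nu> $ i = 0 \<Longrightarrow> T $ i = 0"
    and sum_ln_markov_tensor:
      "(\<Sum>i\<in>UNIV. T $ i * ln (markov_tensor E r M \<nu> $ i / kernel_tensor E A $ i)) =
       (\<Sum>x\<in>UNIV. \<nu> r $ x * ln (\<nu> r $ x)) + bridge_cost E A M \<nu>"
proof -
  have pos: "0 < \<nu> j $ i j" "(a, b) \<in> E \<Longrightarrow> 0 < M a b $ i a $ i b" if "T $ i \<noteq> 0" for i j a b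
  proof -
    have "T $ i > 0" using T that by (auto simp: less_eq_vec_def less_le)
    then show "0 < \<nu> j $ i j" "(a, b) \<in> E \<Longrightarrow> 0 < M a b $ i a $ i b"
      using tensor_le_proj[OF T, of i j] tensor_le_proj2[OF T, of i a b] proj by (auto simp: less_le_trans)
  qed
  have mpos: "0 < markov_tensor E r M \<nu> $ i" if "T $ i \<noteq> 0" for i
    using pos[OF that] by (auto simp: markov_tensor_def intro!: mult_pos_pos prod_pos)
  then show "markov_tensor E r M \<nu> $ i = 0 \<Longrightarrow> T $ i = 0" by fastforce
  define g where "g a b x y = ln (M a b $ x $ y / (\<nu> a $ x * A a b $ x $ y))" for a b x y
  have "T $ i * ln (markov_tensor E r M \<nu> $ i / kernel_tensor E A $ i) =
      T $ i * ln (\<nu> r $ i r) + (\<Sum>(a, b)\<in>E. T $ i * g a b (i a) (i b))" for i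
  proof (cases "T $ i = 0")
    case False
    note p = pos[OF False]
    have "markov_tensor E r M \<nu> $ i / kernel_tensor E A $ i =
      \<nu> r $ i r * (\<Prod>(a, b)\<in>E. M a b $ i a $ i b / (\<nu> a $ i a * A a b $ i a $ i b))"
      by (simp add: markov_tensor_def kernel_tensor_def prod_dividef case_prod_unfold prod.distrib)
    also have "ln \<dots> = ln (\<nu> r $ i r) +
       ln (\<Prod>(a, b)\<in>E. M a b $ i a $ i b / (\<nu> a $ i a * A a b $ i a $ i b))"
      using p A by (intro ln_mult_pos) (auto intro!: prod_pos)
    also have "ln (\<Prod>(a, b)\<in>E. M a b $ i a $ i b / (\<nu> a $ i a * A a b $ i a $ i b)) =
       (\<Sum>e\<in>E. ln ((\<lambda>(a, b). M a b $ i a $ i b / (\<nu> a $ i a * A a b $ i a $ i b)) e))"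
      using p A by (intro ln_prod) (fastforce simp: less_le)+
    also have "\<dots> = (\<Sum>(a, b)\<in>E. g a b (i a) (i b))"
      by (auto simp: g_def intro!: sum.cong)
    finally show ?thesis by (simp add: ring_distribs sum_distrib_left case_prod_unfold)
  qed simp
  then have "(\<Sum>i\<in>UNIV. T $ i * ln (markov_tensor E r M \<nu> $ i / kernel_tensor E A $ i)) =
     (\<Sum>i\<in>UNIV. T $ i * ln (\<nu> r $ i r)) + (\<Sum>(a, b)\<in>E. \<Sum>i\<in>UNIV. T $ i * g a b (i a) (i b))"
    by (simp add: sum.distrib case_prod_unfold sum.swap[of _ E])
  also have "(\<Sum>i\<in>UNIV. T $ i * ln (\<nu> r $ i r)) = (\<Sum>x\<in>UNIV. \<nu> r $ x * ln (\<nu> r $ x))"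
    using sum_proj[of T "\<lambda>x. ln (\<nu> r $ x)" r] by (simp add: proj)
  also have "(\<Sum>(a, b)\<in>E. \<Sum>i\<in>UNIV. T $ i * g a b (i a) (i b)) = bridge_cost E A M \<nu>"
    unfolding bridge_cost_def
  proof (rule sum.cong[OF refl], clarify)
    fix a b assume "(a, b) \<in> E"
    then show "(\<Sum>i\<in>UNIV. T $ i * g a b (i a) (i b)) = (\<Sum>x\<in>UNIV. \<Sum>y\<in>UNIV.
     M a b $ x $ y * ln (M a b $ x $ y / (\<nu> a $ x * A a b $ x $ y)))"
      using sum_proj2[of T "g a b" a b] by (simp add: proj g_def)
  qed
  finally show "(\<Sum>i\<in>UNIV. T $ i * ln (markov_tensor E r M \<nu> $ i / kernel_tensor E A $ i)) =
       (\<Sum>x\<in>UNIV. \<nu> r $ x * ln (\<nu> r $ x)) + bridge_cost E A M \<nu>" .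
qed

lemma markov_tensor_nonneg:
  assumes "\<And>j. 0 \<le> \<nu> j" "\<And>a b. (a, b) \<in> E \<Longrightarrow> 0 \<le> M a b"
  shows "0 \<le> markov_tensor E r M \<nu>"
  using assms by (auto simp: markov_tensor_def less_eq_vec_def intro!: mult_nonneg_nonneg prod_nonneg)

section \<open>Comparison of the two minimization problems\<close>

context rooted
begin

lemma MOT_solution_eq_markov_tensor:
  fixes T :: "real ^ ('v \<Rightarrow> 'n::finite)"
  assumes root_leaf: "r \<in> leaves E"
    and marginals: "\<And>j. j \<in> leaves E \<Longrightarrow> 0 \<le> \<mu> j"
    and stochastic: "\<And>a b. (a, b) \<in> E \<Longrightarrow> row_stochastic (A a b)"
    and eps: "\<epsilon> > 0"
    and kernel: "\<And>a b. (a, b) \<in> E \<Longrightarrow> gibbs \<epsilon> (C a b) = A a b"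
    and MOT: "MOT_solution E C \<epsilon> \<mu> T"
    and SB: "SB_solution E A \<mu> M \<nu>"
  shows "T = markov_tensor E r M \<nu>"
proof -
  define S where "S = markov_tensor E r M \<nu>"
  define K where "K = kernel_tensor E A"
  have Apos: "0 < A a b $ x $ y" if "(a, b) \<in> E" for a b x y
    using kernel[OF that] gibbs_pos by metis
  have K: "kernel_tensor E (\<lambda>a b. gibbs \<epsilon> (C a b)) = K"
    unfolding K_def by (rule kernel_tensor_cong) (rule kernel)
  have Kpos: "0 < K $ i" for i
    unfolding K_def by (rule kernel_tensor_pos) (rule Apos)
  have Tf: "MOT_feasible E \<mu> T" and Topt: "\<And>R. MOT_feasible E \<mu> R \<Longrightarrow>
      MOT_objective E C \<epsilon> T \<le> MOT_objective E C \<epsilon> R"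
    using MOT by (auto simp: MOT_solution_def is_arg_min_linorder)
  have SBf: "SB_feasible E \<mu> (M, \<nu>)" and SBopt: "\<And>P. SB_feasible E \<mu> P \<Longrightarrow>
      SB_objective E A (M, \<nu>) \<le> SB_objective E A P"
    using SB by (auto simp: SB_solution_def is_arg_min_linorder)
  have cons: "consistent E M \<nu>" by (rule SB_feasible_consistent[OF SBf])
  have \<nu>: "0 \<le> \<nu> j" for j
    using SBf marginals by (cases "j \<in> leaves E") (auto simp: SB_feasible_def)
  have S0: "0 \<le> S" unfolding S_def
    using SBf by (intro markov_tensor_nonneg \<nu>) (auto simp: SB_feasible_def)
  have Sproj: "proj j S = \<nu> j" "(a, b) \<in> E \<Longrightarrow> proj2 a b S = M a b" for j a b
    unfolding S_def using markov_proj[OF cons] by auto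
  have Sf: "MOT_feasible E \<mu> S"
    using S0 Sproj SBf by (auto simp: MOT_feasible_def SB_feasible_def)
  \<comment> \<open>As the root is a leaf, all feasible plans share one mass. The transport
    objective is then \<open>kl\<close> relative to \<open>K\<close> up to an increasing affine
    map.\<close>
  have mass: "(\<Sum>i\<in>UNIV. R $ i) = (\<Sum>x\<in>UNIV. \<mu> r $ x)" if "MOT_feasible E \<mu> R" for R
    using that root_leaf sum_proj_UNIV[of r R] by (auto simp: MOT_feasible_def)
  have opt: "kl (($) T) (($) K) \<le> kl (($) R) (($) K)" if "MOT_feasible E \<mu> R" for R
    using Topt[OF that] mass[OF that] mass[OF Tf] eps by (simp add: MOT_objective_eq[OF eps] K)
  have T0: "0 \<le> T" using Tf by (simp add: MOT_feasible_def)
  let ?M = "\<lambda>a b. proj2 a b T" and ?\<nu> = "\<lambda>j. proj j T"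
  \<comment> \<open>\<open>T\<close> is not yet known to be Markov, so Gibbs' inequality compares it
    with the Markov tensor glued from its own projections.\<close>
  define S' where "S' = markov_tensor E r ?M ?\<nu>"
  have f': "SB_feasible E \<mu> (?M, ?\<nu>)" by (rule SB_feasible_proj[OF Tf])
  have S'0: "0 \<le> S'" unfolding S'_def
    by (intro markov_tensor_nonneg proj_nonneg proj2_nonneg T0)
  have "proj r S' = proj r T"
    unfolding S'_def using markov_proj(1)[OF SB_feasible_consistent[OF f']] .
  then have mass': "(\<Sum>i\<in>UNIV. T $ i) = (\<Sum>i\<in>UNIV. S' $ i)"
    using sum_proj_UNIV[of r] by metis
  \<comment> \<open>Both root marginals are the prescribed one, so the root terms agree on the two
    sides of the comparison.\<close>
  have root: "\<nu> r = \<mu> r" "proj r T = \<mu> r"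
    using root_leaf SBf Tf by (auto simp: SB_feasible_def MOT_feasible_def)
  have "kl (($) S) (($) K) = (\<Sum>x\<in>UNIV. \<nu> r $ x * ln (\<nu> r $ x)) + bridge_cost E A M \<nu>"
    using sum_ln_markov_tensor[of S \<nu> E M A r, OF S0 Sproj Apos]
    by (simp add: kl_def K_def S_def)
  also have "\<dots> \<le> (\<Sum>x\<in>UNIV. \<nu> r $ x * ln (\<nu> r $ x)) + bridge_cost E A ?M ?\<nu>"
    using SBopt[OF f'] SB_objective_eq[OF SBf stochastic Apos] SB_objective_eq[OF f' stochastic Apos]
    by simp
  also have "\<dots> = (\<Sum>i\<in>UNIV. T $ i * ln (S' $ i / K $ i))"
    using sum_ln_markov_tensor[of T ?\<nu> E ?M A r, OF T0 refl refl Apos]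
    by (simp add: K_def S'_def root)
  also have "\<dots> \<le> kl (($) T) (($) K)"
    using T0 S'0 Kpos mass' markov_tensor_abs_cont[of T ?\<nu> E ?M A r, OF T0 refl refl Apos]
    by (intro cross_entropy_le_kl(1)) (auto simp: less_eq_vec_def S'_def)
  finally have le: "kl (($) S) (($) K) \<le> kl (($) T) (($) K)" .
  \<comment> \<open>If \<open>T\<close> and \<open>S\<close> differed, their midpoint would be
    feasible and strictly better than \<open>T\<close>, since \<open>S\<close> is at least as good
    as \<open>T\<close>.\<close>
  define R where "R = (\<chi> i. (T $ i + S $ i) / 2)"
  have "proj j R = (1 / 2) *\<^sub>R (proj j T + proj j S)" for j
    by (simp add: vec_eq_iff proj_def R_def sum_divide_distrib[symmetric] sum.distrib)
  moreover have "0 \<le> R"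
    using T0 S0 by (simp add: less_eq_vec_def R_def)
  ultimately have Rf: "MOT_feasible E \<mu> R"
    using Tf Sf by (simp add: MOT_feasible_def)
  show ?thesis
  proof (rule ccontr)
    assume "T \<noteq> markov_tensor E r M \<nu>"
    then have "($) T \<noteq> ($) S" by (auto simp: S_def vec_eq_iff fun_eq_iff)
    then have "2 * kl (\<lambda>i. (T $ i + S $ i) / 2) (($) K) < kl (($) T) (($) K) + kl (($) S) (($) K)"
      using T0 S0 Kpos mass[OF Tf] mass[OF Sf]
      by (intro kl_strictly_midconvex) (auto simp: less_eq_vec_def)
    moreover have "($) R = (\<lambda>i. (T $ i + S $ i) / 2)" by (auto simp: R_def)
    ultimately show False using opt[OF Rf] le by simp
  qed
qed

end

section \<open>The potentials of the bridge\<close>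

lemma prod_index: "(\<Prod>k\<in>S. f k) $ x = (\<Prod>k\<in>S. f k $ x)"
  for f :: "'a \<Rightarrow> real ^ 'n"
  by (induction S rule: infinite_finite_induct) auto

text \<open>The factors of a nonnegative outer product need not be nonnegative: they are only determined
  up to scalars, possibly negative, so positivity is replaced by a constant sign.\<close>

definition one_signed :: "real ^ 'n \<Rightarrow> bool" where
  "one_signed x \<longleftrightarrow> x \<noteq> 0 \<and> ((\<forall>i. 0 \<le> x $ i) \<or> (\<forall>i. x $ i \<le> 0))"

definition strictly_signed :: "real ^ 'n \<Rightarrow> bool" where
  "strictly_signed x \<longleftrightarrow> (\<forall>i. 0 < x $ i) \<or> (\<forall>i. x $ i < 0)"

section \<open>Calculus of vectors of constant sign\<close>

lemma one_signedI:
  assumes "x \<noteq> 0" "c \<noteq> 0" "\<And>i. 0 \<le> c * x $ i"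
  shows "one_signed x"
  using assms by (cases "0 < c") (auto simp: one_signed_def zero_le_mult_iff not_less)

lemma strictly_signed_nonzero: "strictly_signed x \<Longrightarrow> x $ i \<noteq> 0"
  by (auto simp: strictly_signed_def dest: spec[of _ i])

lemma strictly_signed_one_signed: "strictly_signed x \<Longrightarrow> one_signed x"
  using strictly_signed_nonzero[of x undefined]
  by (auto simp: strictly_signed_def one_signed_def less_imp_le)

lemma strictly_signed_mult: "strictly_signed x \<Longrightarrow> strictly_signed y \<Longrightarrow> strictly_signed (x * y)"
  by (auto simp: strictly_signed_def mult_pos_pos mult_neg_neg mult_pos_neg mult_neg_pos)

lemma strictly_signed_prod: "(\<And>k. k \<in> S \<Longrightarrow> strictly_signed (f k)) \<Longrightarrow> strictly_signed (prod f S)"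
  by (induction S rule: infinite_finite_induct)
    (auto simp: strictly_signed_mult, auto simp: strictly_signed_def)

lemma strictly_signed_vdiv: "strictly_signed x \<Longrightarrow> strictly_signed y \<Longrightarrow> strictly_signed (x ./ y)"
  by (auto simp: strictly_signed_def vdiv_def divide_pos_neg divide_neg_neg divide_neg_pos)

lemma one_signed_mult:
  assumes "one_signed x" "strictly_signed y" shows "one_signed (x * y)"
proof -
  obtain i where "x $ i \<noteq> 0" using assms by (auto simp: one_signed_def vec_eq_iff)
  then have "(x * y) $ i \<noteq> 0" using strictly_signed_nonzero[OF assms(2)] by simp
  then have "x * y \<noteq> 0" by (metis zero_index)
  then show ?thesis using assms unfolding one_signed_def strictly_signed_def
    by (auto simp: zero_le_mult_iff mult_le_0_iff less_imp_le)
qed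

text \<open>Every entry of the product is a sum of terms of one sign, at least one of them nonzero.
  A positive matrix thus removes the zeros of \<open>f\<close>.\<close>

lemma strictly_signed_matrix_mult:
  fixes A :: "real ^ 'n ^ 'm"
  assumes A: "\<And>x y. 0 < A $ x $ y" and f: "one_signed f"
  shows "strictly_signed (A *v f)"
proof -
  obtain i where i: "f $ i \<noteq> 0" using f by (auto simp: one_signed_def vec_eq_iff)
  consider "\<forall>i. 0 \<le> f $ i" | "\<forall>i. f $ i \<le> 0" using f by (auto simp: one_signed_def)
  then show ?thesis
  proof cases
    case 1
    then have "0 < f $ i" using i by (simp add: less_le)
    then have "0 < (A *v f) $ x" for x
      unfolding matrix_vector_mult_def using 1 A
      by (auto intro!: sum_pos2[of _ i] mult_nonneg_nonneg less_imp_le[OF A])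
    then show ?thesis by (simp add: strictly_signed_def)
  next
    case 2
    then have "0 < - f $ i" using i by (simp add: less_le)
    then have "0 < (\<Sum>y\<in>UNIV. A $ x $ y * (- f $ y))" for x
      using 2 A by (intro sum_pos2[of _ i]) (auto simp: mult_le_0_iff mult_less_0_iff less_imp_le[OF A])
    then have "(A *v f) $ x < 0" for x
      unfolding matrix_vector_mult_def by (simp add: sum_negf)
    then show ?thesis by (simp add: strictly_signed_def)
  qed
qed

section \<open>Outer products and the scaling of their factors\<close>

lemma outer_fun_upd: "outer u $ (i(j := x)) = u j $ x * (\<Prod>k\<in>- {j}. u k $ i k)"
proof -
  have "outer u $ (i(j := x)) = u j $ x * (\<Prod>k\<in>UNIV - {j}. u k $ (i(j := x)) k)"
    by (simp add: outer_def prod.remove[of UNIV j])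
  also have "(\<Prod>k\<in>UNIV - {j}. u k $ (i(j := x)) k) = (\<Prod>k\<in>- {j}. u k $ i k)"
    by (rule prod.cong) auto
  finally show ?thesis .
qed

text \<open>Varying only the coordinate \<open>j\<close> of the family \<open>i\<close> shows
  \<open>u j\<close> and \<open>w j\<close> to be proportional. The ratios can be read off at
  \<open>i\<close> and multiply to 1 because the two products agree there.\<close>

lemma outer_eq_scale:
  assumes eq: "outer u = outer w" and nz: "outer u $ i \<noteq> 0"
  shows "\<exists>c. (\<Prod>j\<in>UNIV. c j) = 1 \<and> (\<forall>j. u j = c j *\<^sub>R w j)"
proof (intro exI[of _ "\<lambda>j. u j $ i j / w j $ i j"] conjI allI)
  have unz: "u j $ i j \<noteq> 0" and wnz: "w j $ i j \<noteq> 0" for j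
    using nz nz[unfolded eq] by (auto simp: outer_def)
  show "(\<Prod>j\<in>UNIV. u j $ i j / w j $ i j) = 1"
    using eq nz by (simp add: prod_dividef outer_def vec_eq_iff)
  fix j
  define P Q where "P = (\<Prod>k\<in>- {j}. u k $ i k)" and "Q = (\<Prod>k\<in>- {j}. w k $ i k)"
  have P: "P \<noteq> 0" using unz by (simp add: P_def)
  have *: "u j $ x * P = w j $ x * Q" for x
    using eq outer_fun_upd[of u i j x] outer_fun_upd[of w i j x] by (simp add: P_def Q_def)
  have "u j $ x = u j $ i j / w j $ i j * w j $ x" for x
  proof -
    have "u j $ x = Q / P * w j $ x" "u j $ i j = Q / P * w j $ i j"
      using *[of x] *[of "i j"] P by (simp_all add: field_simps)
    then show ?thesis using wnz[of j] by simp
  qed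
  then show "u j = (u j $ i j / w j $ i j) *\<^sub>R w j"
    unfolding vec_eq_iff vector_scaleR_component real_scaleR_def by blast
qed

text \<open>\<open>SB_representation\<close> with its two witnesses exposed as arguments.\<close>

definition represents :: "('v::finite \<times> 'v) set \<Rightarrow> 'v \<Rightarrow> ('v \<Rightarrow> 'v \<Rightarrow> real ^ 'n ^ 'n) \<Rightarrow>
    ('v \<Rightarrow> 'v \<Rightarrow> real ^ 'n ^ 'n) \<Rightarrow> ('v \<Rightarrow> real ^ 'n) \<Rightarrow> ('v \<Rightarrow> real ^ 'n::finite) \<Rightarrow>
    ('v \<Rightarrow> real ^ 'n) \<Rightarrow> ('v \<Rightarrow> real ^ 'n) \<Rightarrow> bool" where
  "represents E r A M \<nu> v \<phi> \<psi> \<longleftrightarrow>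
     (\<forall>j. \<phi> j = (if j \<in> leaves E - {r} then v j else (\<Prod>k | (j, k) \<in> E. A j k *v \<phi> k))) \<and>
     \<psi> r = 1 ./ v r \<and>
     (\<forall>j. j \<noteq> r \<longrightarrow> \<psi> j = transpose (A (parent E j) j) *v
        (\<psi> (parent E j) * (\<phi> (parent E j) ./ (A (parent E j) j *v \<phi> j)))) \<and>
     (\<forall>j. \<nu> j = \<phi> j * \<psi> j) \<and>
     (\<forall>(a, b) \<in> E. M a b = diag (\<psi> a * (\<phi> a ./ (A a b *v \<phi> b))) ** A a b ** diag (\<phi> b))"

lemma SB_representation_iff: "SB_representation E r A M \<nu> v \<longleftrightarrow> (\<exists>\<phi> \<psi>. represents E r A M \<nu> v \<phi> \<psi>)"
  by (simp add: SB_representation_def represents_def Let_def)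

lemma representsD:
  assumes "represents E r A M \<nu> v \<phi> \<psi>"
  shows "\<phi> j = (if j \<in> leaves E - {r} then v j else (\<Prod>k | (j, k) \<in> E. A j k *v \<phi> k))"
    and "\<psi> r = 1 ./ v r"
    and "j \<noteq> r \<Longrightarrow> \<psi> j = transpose (A (parent E j) j) *v
        (\<psi> (parent E j) * (\<phi> (parent E j) ./ (A (parent E j) j *v \<phi> j)))"
    and "\<nu> j $ x = \<phi> j $ x * \<psi> j $ x"
    and "(a, b) \<in> E \<Longrightarrow> M a b $ x $ y =
        \<psi> a $ x * \<phi> a $ x / (A a b *v \<phi> b) $ x * A a b $ x $ y * \<phi> b $ y"
proof -
  note D = assms[unfolded represents_def]
  from D show "\<phi> j = (if j \<in> leaves E - {r} then v j else (\<Prod>k | (j, k) \<in> E. A j k *v \<phi> k))"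
    by (elim conjE allE)
  from D show "\<psi> r = 1 ./ v r" by (elim conjE)
  from D show "j \<noteq> r \<Longrightarrow> \<psi> j = transpose (A (parent E j) j) *v
      (\<psi> (parent E j) * (\<phi> (parent E j) ./ (A (parent E j) j *v \<phi> j)))"
    by blast
  from D have "\<nu> j = \<phi> j * \<psi> j" by blast
  then show "\<nu> j $ x = \<phi> j $ x * \<psi> j $ x" by simp
  assume "(a, b) \<in> E"
  with D have "M a b = diag (\<psi> a * (\<phi> a ./ (A a b *v \<phi> b))) ** A a b ** diag (\<phi> b)" by blast
  then show "M a b $ x $ y = \<psi> a $ x * \<phi> a $ x / (A a b *v \<phi> b) $ x * A a b $ x $ y * \<phi> b $ y"
    by (simp add: diag_mult mult_diag vdiv_def)
qed

section \<open>Tensors and marginals built from potentials\<close>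

context rooted
begin

text \<open>Each \<open>\<phi> j\<close> is a leaf factor \<open>w j\<close> times
  \<open>g j\<close>, the product of the messages \<open>A j k *v \<phi> k\<close> from its
  children. With the root factor included, the numerators contain every \<open>g j\<close> once, and
  so do the denominators grouped by source; only the leaf factors survive.\<close>

lemma telescope:
  fixes A :: "'v \<Rightarrow> 'v \<Rightarrow> real ^ 'n ^ 'n::finite"
  assumes root_leaf: "r \<in> leaves E"
    and \<phi>: "\<And>j. \<phi> j = (if j \<in> leaves E - {r} then v j else (\<Prod>k | (j, k) \<in> E. A j k *v \<phi> k))"
    and nz: "\<And>a b x. (a, b) \<in> E \<Longrightarrow> (A a b *v \<phi> b) $ x \<noteq> 0"
  shows "\<phi> r $ i r * (1 ./ v r) $ i r * (\<Prod>(a, b)\<in>E. \<phi> b $ i b / (A a b *v \<phi> b) $ i a) =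
    outer (MOT_factor E r v) $ i"
proof -
  define g where "g a = (\<Prod>b | (a, b) \<in> E. (A a b *v \<phi> b) $ i a)" for a
  define w where "w j = (if j \<in> leaves E - {r} then v j $ i j else 1)" for j
  have gnz: "g a \<noteq> 0" for a using nz by (simp add: g_def)
  have g1: "g a = 1" if "a \<in> leaves E - {r}" for a
    using leaf_no_child[of a] that by (simp add: g_def)
  have \<phi>w: "\<phi> j $ i j = w j * g j" for j
    using g1[of j] by (subst \<phi>) (auto simp: w_def g_def prod_index)
  have "(\<Prod>(a, b)\<in>E. \<phi> b $ i b / (A a b *v \<phi> b) $ i a) =
     (\<Prod>(a, b)\<in>E. \<phi> b $ i b) / (\<Prod>(a, b)\<in>E. (A a b *v \<phi> b) $ i a)"
    by (simp add: prod_dividef case_prod_unfold)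
  also have "(\<Prod>(a, b)\<in>E. (A a b *v \<phi> b) $ i a) = prod g UNIV"
    unfolding prod_edges_by_source g_def ..
  also have "(\<Prod>(a, b)\<in>E. \<phi> b $ i b) = (\<Prod>b\<in>- {r}. \<phi> b $ i b)"
    by (rule prod_edges)
  finally have "\<phi> r $ i r * (1 ./ v r) $ i r * (\<Prod>(a, b)\<in>E. \<phi> b $ i b / (A a b *v \<phi> b) $ i a) =
     (1 ./ v r) $ i r * ((\<phi> r $ i r * (\<Prod>b\<in>- {r}. \<phi> b $ i b)) / prod g UNIV)"
    by simp
  also have "\<phi> r $ i r * (\<Prod>b\<in>- {r}. \<phi> b $ i b) = prod w UNIV * prod g UNIV"
    using prod.remove[of UNIV r "\<lambda>b. \<phi> b $ i b"]
    by (simp add: Compl_eq_Diff_UNIV[symmetric] \<phi>w prod.distrib)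
  also have "\<dots> / prod g UNIV = prod w UNIV" using gnz by simp
  also have "(1 ./ v r) $ i r * prod w UNIV = outer (MOT_factor E r v) $ i"
  proof -
    have "prod w (- {r}) = (\<Prod>j\<in>- {r}. MOT_factor E r v j $ i j)"
      by (rule prod.cong) (auto simp: w_def MOT_factor_def)
    then show ?thesis
      using root_leaf
      by (simp add: outer_def prod.remove[of UNIV r] Compl_eq_Diff_UNIV[symmetric])
       (simp add: w_def MOT_factor_def)
  qed
  finally show ?thesis .
qed

text \<open>Dividing \<open>M a b\<close> by \<open>\<nu> a\<close> leaves a kernel entry times a
  ratio of potentials, unless \<open>\<nu> a\<close> vanishes. Edges start only at the root or at
  inner vertices, so zeros of the root marginal are the only exception.\<close>

lemma markov_tensor_represented:
  fixes A :: "'v \<Rightarrow> 'v \<Rightarrow> real ^ 'n ^ 'n::finite"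
  assumes root_leaf: "r \<in> leaves E"
    and rep: "represents E r A M \<nu> v \<phi> \<psi>"
    and nz: "\<And>a b x. (a, b) \<in> E \<Longrightarrow> (A a b *v \<phi> b) $ x \<noteq> 0"
    and inner: "\<And>a x. a \<notin> leaves E \<Longrightarrow> \<nu> a $ x \<noteq> 0"
  shows "markov_tensor E r M \<nu> = kernel_tensor E A * outer (MOT_factor E r v)"
proof -
  note rep = representsD[OF rep]
  have "markov_tensor E r M \<nu> $ i = kernel_tensor E A $ i * outer (MOT_factor E r v) $ i" for i
  proof (cases "\<nu> r $ i r = 0")
    \<comment> \<open>Here \<open>\<phi> r\<close> is nonzero, being a product of nonzero messages,
      so \<open>1 ./ v r\<close> must vanish and both sides are 0.\<close>
    case True
    have "\<phi> r $ i r \<noteq> 0"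
      using nz by (subst rep(1)) (auto simp: prod_index)
    then have "(1 ./ v r) $ i r = 0" using True rep(2) rep(4)[of r] by auto
    then show ?thesis using True telescope[OF root_leaf rep(1) nz, of i]
      by (simp add: markov_tensor_def)
  next
    case False
    have *: "M a b $ i a $ i b / \<nu> a $ i a = A a b $ i a $ i b * (\<phi> b $ i b / (A a b *v \<phi> b) $ i a)"
      if ab: "(a, b) \<in> E" for a b
    proof -
      have "\<nu> a $ i a \<noteq> 0"
        using False inner[of a] leaf_no_child[of a] ab by (cases "a = r") auto
      then show ?thesis using nz[OF ab] by (simp add: rep(5)[OF ab] rep(4) field_simps)
    qed
    have "markov_tensor E r M \<nu> $ i = \<phi> r $ i r * \<psi> r $ i r *
       (\<Prod>(a, b)\<in>E. A a b $ i a $ i b * (\<phi> b $ i b / (A a b *v \<phi> b) $ i a))"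
      unfolding markov_tensor_def using * by (auto simp: rep(4) intro!: prod.cong)
    also have "\<dots> = kernel_tensor E A $ i * (\<phi> r $ i r * \<psi> r $ i r *
       (\<Prod>(a, b)\<in>E. \<phi> b $ i b / (A a b *v \<phi> b) $ i a))"
      by (simp add: kernel_tensor_def case_prod_unfold prod.distrib del: times_divide_eq_right)
    finally show ?thesis using telescope[OF root_leaf rep(1) nz, of i] by (simp add: rep(2))
  qed
  then show ?thesis by (simp add: vec_eq_iff)
qed

text \<open>A representation makes no sign assumption on \<open>v\<close>. One row of
  \<open>M a b\<close> with nonzero sum suffices: its entries are nonnegative multiples of
  \<open>c * \<phi> b $ y\<close> with \<open>c \<noteq> 0\<close>, so \<open>\<phi> b\<close> has
  constant sign, and the positive matrix makes that sign strict.\<close>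

lemma represented_nonvanishing:
  fixes A :: "'v \<Rightarrow> 'v \<Rightarrow> real ^ 'n ^ 'n::finite"
  assumes rep: "represents E r A M \<nu> v \<phi> \<psi>"
    and ab: "(a, b) \<in> E" and A: "\<And>x y. 0 < A a b $ x $ y"
    and M: "0 \<le> M a b" and row: "(\<Sum>y\<in>UNIV. M a b $ z $ y) \<noteq> 0"
  shows "(A a b *v \<phi> b) $ x \<noteq> 0"
proof -
  define c where "c = \<psi> a $ z * \<phi> a $ z / (A a b *v \<phi> b) $ z"
  have Meq: "M a b $ z $ y = c * A a b $ z $ y * \<phi> b $ y" for y
    using representsD(5)[OF rep ab] by (simp add: c_def)
  have c: "c \<noteq> 0" using row by (auto simp: Meq)
  have "0 \<le> A a b $ z $ y * (c * \<phi> b $ y)" for y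
  proof -
    have "0 \<le> M a b $ z $ y" using M by (simp add: less_eq_vec_def)
    then show ?thesis by (simp add: Meq mult_ac)
  qed
  then have "0 \<le> c * \<phi> b $ y" for y
    using A[of z y] by (metis zero_le_mult_iff not_le)
  moreover have "\<phi> b \<noteq> 0" using row by (auto simp: Meq)
  ultimately have "one_signed (\<phi> b)" using c one_signedI by blast
  then show ?thesis using strictly_signed_matrix_mult[of "A a b"] A strictly_signed_nonzero by blast
qed

text \<open>The potentials are defined by well-founded recursion, and constancy of sign is
  propagated along both recursions, so no message vanishes. The marginals they define are
  consistent, though their sign is not controlled here.\<close>

lemma ex_represents:
  fixes A :: "'v \<Rightarrow> 'v \<Rightarrow> real ^ 'n ^ 'n::finite"
  assumes root_leaf: "r \<in> leaves E"
    and A: "\<And>a b x y. (a, b) \<in> E \<Longrightarrow> 0 < A a b $ x $ y"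
    and v: "\<And>j. j \<in> leaves E - {r} \<Longrightarrow> one_signed (v j)" and vr: "one_signed (1 ./ v r)"
  shows "\<exists>M \<nu> \<phi> \<psi>. represents E r A M \<nu> v \<phi> \<psi> \<and> consistent E M \<nu> \<and>
    (\<forall>a x. a \<notin> leaves E \<longrightarrow> \<nu> a $ x \<noteq> 0) \<and>
    (\<forall>a b x. (a, b) \<in> E \<longrightarrow> (A a b *v \<phi> b) $ x \<noteq> 0)"
proof -
  define F where "F \<phi> j = (if j \<in> leaves E - {r} then v j else (\<Prod>k | (j, k) \<in> E. A j k *v \<phi> k))"
    for \<phi> j
  define \<phi> where "\<phi> = wfrec (E\<inverse>) F"
  define H where "H \<psi> j = (if j = r then 1 ./ v r else transpose (A (parent E j) j) *v
        (\<psi> (parent E j) * (\<phi> (parent E j) ./ (A (parent E j) j *v \<phi> j))))" for \<psi> j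
  define \<psi> where "\<psi> = wfrec E H"
  have "adm_wf (E\<inverse>) F" by (auto simp: adm_wf_def F_def intro!: prod.cong)
  then have "\<phi> = F \<phi>" unfolding \<phi>_def by (rule wfrec_fixpoint[OF wf_edges_converse])
  then have \<phi>: "\<phi> j = (if j \<in> leaves E - {r} then v j else (\<Prod>k | (j, k) \<in> E. A j k *v \<phi> k))" for j
    unfolding F_def by meson
  have "adm_wf E H" using parent_edge by (auto simp: adm_wf_def H_def)
  then have "\<psi> = H \<psi>" unfolding \<psi>_def by (rule wfrec_fixpoint[OF wf_edges])
  then have \<psi>: "\<psi> j = (if j = r then 1 ./ v r else transpose (A (parent E j) j) *v
        (\<psi> (parent E j) * (\<phi> (parent E j) ./ (A (parent E j) j *v \<phi> j))))" for j
    unfolding H_def by meson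
  have os\<phi>: "one_signed (\<phi> j)" for j
  proof (induction j rule: wf_induct_rule[OF wf_edges_converse])
    case (1 j)
    then have "strictly_signed (A j k *v \<phi> k)" if "(j, k) \<in> E" for k
      using that A by (intro strictly_signed_matrix_mult) auto
    then show ?case using v
      by (subst \<phi>) (auto intro!: strictly_signed_one_signed strictly_signed_prod)
  qed
  have ssA: "strictly_signed (A a b *v \<phi> b)" if "(a, b) \<in> E" for a b
    using that A os\<phi> by (intro strictly_signed_matrix_mult) auto
  have ss\<phi>: "strictly_signed (\<phi> j)" if "j \<notin> leaves E - {r}" for j
    using that ssA by (subst \<phi>) (auto intro!: strictly_signed_prod)
  \<comment> \<open>The parent is not a non-root leaf, so its \<phi> and the message from
    \<open>j\<close> are strictly signed. Multiplication by the positive transposed matrix then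
    removes any zeros of \<psi> at the parent; zeros of \<psi> can occur only at the root.\<close>
  have ss\<psi>': "strictly_signed (\<psi> j)" if "one_signed (\<psi> (parent E j))" "j \<noteq> r" for j
  proof -
    have p: "(parent E j, j) \<in> E" using that parent_edge by blast
    then have "parent E j \<notin> leaves E - {r}" using leaf_no_child by blast
    then have "strictly_signed (\<phi> (parent E j) ./ (A (parent E j) j *v \<phi> j))"
      using ss\<phi> ssA[OF p] strictly_signed_vdiv by blast
    then show ?thesis using that A[OF p]
      by (subst \<psi>) (auto simp: transpose_def simp del: transpose_matrix_vector
        intro!: strictly_signed_matrix_mult one_signed_mult)
  qed
  have os\<psi>: "one_signed (\<psi> j)" for j
  proof (induction j rule: wf_induct_rule[OF wf_edges])
    case (1 j)
    show ?case
    proof (cases "j = r")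
      case True
      then show ?thesis using vr by (subst \<psi>) auto
    next
      case False
      then show ?thesis using 1 parent_edge ss\<psi>' strictly_signed_one_signed by blast
    qed
  qed
  have ss\<psi>: "strictly_signed (\<psi> j)" if "j \<noteq> r" for j using ss\<psi>' os\<psi> that by blast
  define \<nu> where "\<nu> j = \<phi> j * \<psi> j" for j
  define M where "M a b = diag (\<psi> a * (\<phi> a ./ (A a b *v \<phi> b))) ** A a b ** diag (\<phi> b)" for a b
  have rep: "represents E r A M \<nu> v \<phi> \<psi>"
    unfolding represents_def using \<phi> \<psi> by (auto simp: \<nu>_def M_def simp del: transpose_matrix_vector)
  have "consistent E M \<nu>"
    unfolding consistent_def
  proof (clarify)
    fix a b x y assume ab: "(a, b) \<in> E"
    note nz = strictly_signed_nonzero[OF ssA[OF ab]]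
    have br: "b \<noteq> r" and pb: "parent E b = a" using ab no_edge_to_root parent_eq by auto
    note Meq = representsD(5)[OF rep ab]
    \<comment> \<open>Row sums reproduce the message \<open>A a b *v \<phi> b\<close>, which cancels
      the divisor. Column sums reproduce the recursion for \<psi>, multiplied by
      \<open>\<phi> b\<close>.\<close>
    have "(\<Sum>y\<in>UNIV. M a b $ x $ y) =
      \<psi> a $ x * \<phi> a $ x / (A a b *v \<phi> b) $ x * (\<Sum>y\<in>UNIV. A a b $ x $ y * \<phi> b $ y)"
      by (simp add: Meq sum_distrib_left sum_divide_distrib mult_ac)
    also have "\<dots> = \<nu> a $ x"
      using nz[of x] by (simp add: \<nu>_def matrix_vector_mult_def)
    finally have row: "(\<Sum>y\<in>UNIV. M a b $ x $ y) = \<nu> a $ x" .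
    have "\<psi> b $ y = (\<Sum>x\<in>UNIV. A a b $ x $ y * (\<psi> a $ x * (\<phi> a $ x / (A a b *v \<phi> b) $ x)))"
      using br pb by (subst \<psi>)
       (simp add: vdiv_def matrix_vector_mult_def transpose_def del: transpose_matrix_vector)
    then have col: "(\<Sum>x\<in>UNIV. M a b $ x $ y) = \<nu> b $ y"
      by (simp add: Meq \<nu>_def sum_distrib_left sum_divide_distrib mult_ac)
    \<comment> \<open>As \<open>\<psi> b\<close> has no zeros, \<open>\<nu> b\<close> vanishes only
      where \<open>\<phi> b\<close> does.\<close>
    have "M a b $ x $ y = 0" if "\<nu> a $ x = 0 \<or> \<nu> b $ y = 0"
      using that strictly_signed_nonzero[OF ss\<psi>[OF br], of y] by (auto simp: Meq \<nu>_def)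
    with row col show "(\<Sum>y\<in>UNIV. M a b $ x $ y) = \<nu> a $ x \<and>
      (\<Sum>x\<in>UNIV. M a b $ x $ y) = \<nu> b $ y \<and>
      (\<nu> a $ x = 0 \<or> \<nu> b $ y = 0 \<longrightarrow> M a b $ x $ y = 0)" by blast
  qed
  moreover have "\<nu> a $ x \<noteq> 0" if "a \<notin> leaves E" for a x
  proof -
    have "a \<noteq> r" using that root_leaf by blast
    then show ?thesis
      using that strictly_signed_nonzero[OF ss\<psi>] strictly_signed_nonzero[OF ss\<phi>] by (simp add: \<nu>_def)
  qed
  ultimately show ?thesis using rep strictly_signed_nonzero[OF ssA] by blast
qed

end

text \<open>Factors of an outer product are determined only up to scalars with product 1. The
  relation between \<open>u\<close> and \<open>v\<close> is therefore stated as an equality for a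
  suitable \<open>v\<close> and up to such scalars for every \<open>v\<close>. The nonzero leaf
  marginal supplies an index family at which \<open>T\<close> does not vanish.\<close>

theorem theorem4p4:
  fixes E :: "('v::finite \<times> 'v) set" and r :: 'v
    and A C :: "'v \<Rightarrow> 'v \<Rightarrow> real ^ 'n ^ 'n::finite"
    and \<epsilon> :: real
    and \<mu> u \<nu> :: "'v \<Rightarrow> real ^ 'n"
    and T :: "real ^ ('v \<Rightarrow> 'n)"
    and M :: "'v \<Rightarrow> 'v \<Rightarrow> real ^ 'n ^ 'n"
  assumes tree: "rooted_tree E r" and root_leaf: "r \<in> leaves E"
    and marginals_nonneg: "\<And>j. j \<in> leaves E \<Longrightarrow> 0 \<le> \<mu> j"
    and equal_mass:
      "\<And>j k. j \<in> leaves E \<Longrightarrow> k \<in> leaves E \<Longrightarrow> (\<Sum>x\<in>UNIV. \<mu> j $ x) = (\<Sum>x\<in>UNIV. \<mu> k $ x)"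
    and stochastic: "\<And>a b. (a, b) \<in> E \<Longrightarrow> row_stochastic (A a b)"
    and eps: "\<epsilon> > 0"
    and cost_nonneg: "\<And>a b. (a, b) \<in> E \<Longrightarrow> 0 \<le> C a b"
    and kernel: "\<And>a b. (a, b) \<in> E \<Longrightarrow> gibbs \<epsilon> (C a b) = A a b"
    and MOT: "MOT_solution E C \<epsilon> \<mu> T"
    and MOT_form: "T = kernel_tensor E (\<lambda>a b. gibbs \<epsilon> (C a b)) * outer u"
    and u_inner: "\<And>j. j \<notin> leaves E \<Longrightarrow> u j = 1"
    and SB: "SB_solution E A \<mu> M \<nu>"
  shows "(\<forall>j. proj j T = \<nu> j) \<and>
    (\<forall>(a, b) \<in> E. proj2 a b T = M a b) \<and>
    ((\<exists>j \<in> leaves E. \<mu> j \<noteq> 0) \<longrightarrow>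
      (\<exists>v. SB_representation E r A M \<nu> v \<and>
         (\<forall>j \<in> leaves E. u j = (if j = r then 1 ./ v r else v j))) \<and>
      (\<forall>v. SB_representation E r A M \<nu> v \<longrightarrow>
         T = kernel_tensor E (\<lambda>a b. gibbs \<epsilon> (C a b)) * outer (MOT_factor E r v) \<and>
         (\<exists>c. (\<Prod>j\<in>leaves E. c j) = 1 \<and>
              (\<forall>j \<in> leaves E. u j = c j *\<^sub>R (if j = r then 1 ./ v r else v j)))))"
proof -
  interpret rooted E r by unfold_locales (rule tree)
  have K: "kernel_tensor E (\<lambda>a b. gibbs \<epsilon> (C a b)) = kernel_tensor E A"
    by (rule kernel_tensor_cong) (rule kernel)
  have Apos: "0 < A a b $ x $ y" if "(a, b) \<in> E" for a b x y
    using kernel[OF that] gibbs_pos by metis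
  have Kpos: "0 < kernel_tensor E A $ i" for i
    by (rule kernel_tensor_pos) (rule Apos)
  have Tm: "T = markov_tensor E r M \<nu>"
    by (rule MOT_solution_eq_markov_tensor[OF root_leaf marginals_nonneg stochastic eps kernel MOT SB])
  have T0: "0 \<le> T" and Tleaf: "j \<in> leaves E \<Longrightarrow> proj j T = \<mu> j" for j
    using MOT by (auto simp: MOT_solution_def is_arg_min_def MOT_feasible_def)
  have SBf: "SB_feasible E \<mu> (M, \<nu>)"
    using SB by (auto simp: SB_solution_def is_arg_min_def)
  note cons = SB_feasible_consistent[OF SBf]
  have Tproj: "proj j T = \<nu> j" "(a, b) \<in> E \<Longrightarrow> proj2 a b T = M a b" for j a b
    unfolding Tm using markov_proj[OF cons] by auto
  have Ti: "T $ i = kernel_tensor E A $ i * outer u $ i" for i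
    using MOT_form K by simp
  have "(\<exists>v. SB_representation E r A M \<nu> v \<and>
         (\<forall>j \<in> leaves E. u j = (if j = r then 1 ./ v r else v j))) \<and>
      (\<forall>v. SB_representation E r A M \<nu> v \<longrightarrow>
         T = kernel_tensor E A * outer (MOT_factor E r v) \<and>
         (\<exists>c. (\<Prod>j\<in>leaves E. c j) = 1 \<and>
              (\<forall>j \<in> leaves E. u j = c j *\<^sub>R (if j = r then 1 ./ v r else v j))))"
    if mass: "\<exists>j \<in> leaves E. \<mu> j \<noteq> 0"
  proof -
    obtain i where i: "T $ i \<noteq> 0"
    proof (rule ccontr)
      assume "\<not> thesis"
      then have "T $ i = 0" for i using that by blast
      then have "proj j T = 0" for j by (simp add: proj_def vec_eq_iff)
      then show False using mass Tleaf by metis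
    qed
    have Tpos: "0 < T $ i'" if "T $ i' \<noteq> 0" for i'
      using that T0 by (auto simp: less_eq_vec_def less_le)
    have ui: "u j $ i j \<noteq> 0" for j using i by (auto simp: Ti outer_def)
    have \<nu>i: "\<nu> j $ i j \<noteq> 0" for j
      using tensor_le_proj[OF T0, of i j] Tpos[OF i] by (simp add: Tproj)
    \<comment> \<open>Changing an inner coordinate of \<open>i\<close> leaves \<open>outer u\<close>
      unchanged, since \<open>u a\<close> is all ones there. So \<open>T\<close> stays positive and
      the inner marginals have no zeros.\<close>
    have inner: "\<nu> a $ x \<noteq> 0" if "a \<notin> leaves E" for a x
    proof -
      have "T $ (i(a := x)) \<noteq> 0"
        using ui Kpos[of "i(a := x)"] by (simp add: Ti outer_fun_upd u_inner[OF that])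
      then show ?thesis
        using tensor_le_proj[OF T0, of "i(a := x)" a] Tpos by (fastforce simp: Tproj)
    qed
    \<comment> \<open>Along the coordinate \<open>j\<close> the nonnegative tensor is a positive
      kernel entry times \<open>u j\<close> times a fixed nonzero number, whose sign may be
      negative.\<close>
    have u: "one_signed (u j)" for j
    proof -
      define Q where "Q = (\<Prod>k\<in>- {j}. u k $ i k)"
      have Q: "Q \<noteq> 0" using ui by (simp add: Q_def)
      have "0 \<le> u j $ x * Q" for x
      proof -
        have "0 \<le> T $ (i(j := x))" using T0 by (simp add: less_eq_vec_def)
        then show ?thesis
          using Kpos[of "i(j := x)"] by (simp add: Ti outer_fun_upd Q_def zero_le_mult_iff)
      qed
      then have "0 \<le> Q * u j $ x" for x by (simp add: mult.commute)
      moreover have "u j \<noteq> 0" using ui by (metis zero_index)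
      ultimately show ?thesis using Q one_signedI by blast
    qed
    have "\<exists>v. SB_representation E r A M \<nu> v \<and>
         (\<forall>j \<in> leaves E. u j = (if j = r then 1 ./ v r else v j))"
    proof -
      \<comment> \<open>The root vector is inverted twice; with \<open>1 / 0 = 0\<close> this
        returns \<open>u r\<close> exactly, even at its zeros.\<close>
      define v where "v j = (if j = r then 1 ./ u r else u j)" for j
      have vr: "1 ./ v r = u r" by (simp add: v_def vdiv_def vec_eq_iff)
      have uv: "MOT_factor E r v = u"
        using vr u_inner by (auto simp: MOT_factor_def v_def fun_eq_iff)
      obtain M' \<nu>' \<phi> \<psi> where rep: "represents E r A M' \<nu>' v \<phi> \<psi>" and cons': "consistent E M' \<nu>'"
        and "\<And>a x. a \<notin> leaves E \<Longrightarrow> \<nu>' a $ x \<noteq> 0"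
        and "\<And>a b x. (a, b) \<in> E \<Longrightarrow> (A a b *v \<phi> b) $ x \<noteq> 0"
        using ex_represents[of A v, OF root_leaf Apos] u vr by (auto simp: v_def)
      \<comment> \<open>The constructed marginals glue to \<open>T\<close>, so they are the
        projections of \<open>T\<close>, which are already known to be the bridge solution.\<close>
      then have "markov_tensor E r M' \<nu>' = T"
        using markov_tensor_represented[OF root_leaf rep] uv MOT_form K by simp
      then have "proj j T = \<nu>' j" "(a, b) \<in> E \<Longrightarrow> proj2 a b T = M' a b" for j a b
        using markov_proj[OF cons'] by auto
      then have "\<nu>' = \<nu>" "\<And>a b. (a, b) \<in> E \<Longrightarrow> M' a b = M a b" using Tproj by auto
      then have "represents E r A M \<nu> v \<phi> \<psi>" using rep by (auto simp: represents_def)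
      then show ?thesis using vr by (intro exI[of _ v]) (auto simp: SB_representation_iff v_def)
    qed
    moreover have "T = kernel_tensor E A * outer (MOT_factor E r v) \<and>
         (\<exists>c. (\<Prod>j\<in>leaves E. c j) = 1 \<and>
              (\<forall>j \<in> leaves E. u j = c j *\<^sub>R (if j = r then 1 ./ v r else v j)))"
      if "SB_representation E r A M \<nu> v" for v
    proof -
      obtain \<phi> \<psi> where rep: "represents E r A M \<nu> v \<phi> \<psi>"
        using \<open>SB_representation E r A M \<nu> v\<close> unfolding SB_representation_iff by blast
      have "(A a b *v \<phi> b) $ x \<noteq> 0" if ab: "(a, b) \<in> E" for a b x
      proof (rule represented_nonvanishing[OF rep ab Apos[OF ab]])
        show "0 \<le> M a b" using SBf ab by (auto simp: SB_feasible_def)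
        show "(\<Sum>y\<in>UNIV. M a b $ i a $ y) \<noteq> 0" using \<nu>i consistentD(1)[OF cons ab] by simp
      qed
      then have T: "T = kernel_tensor E A * outer (MOT_factor E r v)"
        unfolding Tm by (intro markov_tensor_represented[OF root_leaf rep] inner) auto
      have "outer u $ k = outer (MOT_factor E r v) $ k" for k
        using Ti[of k] Kpos[of k] arg_cong[OF T, of "\<lambda>S. S $ k"] by simp
      then have "outer u = outer (MOT_factor E r v)" by (simp add: vec_eq_iff)
      moreover have "outer u $ i \<noteq> 0" using i Ti by auto
      ultimately obtain c where c: "(\<Prod>j\<in>UNIV. c j) = 1" "\<And>j. u j = c j *\<^sub>R MOT_factor E r v j"
        using outer_eq_scale by metis
      \<comment> \<open>At inner vertices both factors are all ones, so the scalar is 1 and the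
        product reduces to the leaves.\<close>
      have "c j = 1" if "j \<notin> leaves E" for j
        using c(2)[of j] u_inner[OF that] that by (simp add: MOT_factor_def vec_eq_iff)
      then have "(\<Prod>j\<in>leaves E. c j) = (\<Prod>j\<in>UNIV. c j)"
        by (intro prod.mono_neutral_left) auto
      then show ?thesis using T c by (intro conjI exI[of _ c]) (auto simp: MOT_factor_def)
    qed
    ultimately show ?thesis by blast
  qed
  then show ?thesis unfolding K using Tproj by blast
qed

end
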